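(* Let $\bm U=(U_t)_{t\in[0,1]}\in C[0,1]$ be a copula process such that for some $\delta>0$ and some $D$-norm $\|\cdot\|_D$ on $E[0,1]$ $$P\bigl(\bm U\le1_{[0,1]}+cf\bigr)=1-c\|f\|_D+O(c^{1+\delta})\quad\text{as }c\downarrow0$$ holds uniformly for all $f\in E^-[0,1]$ satisfying $\|f\|_\infty\le1$. Choose a grid of points $0=t_1^{(d)}<t_2^{(d)}<\dots<t_d^{(d)}=1$ with $d=d_n\to\infty$ and $\max_{1\le i\le d_n-1}\bigl|t_{i+1}^{(d_n)}-t_i^{(d_n)}\bigr|\to0$ as $n\to\infty$. Fix $k\in\mathbb{N}$ and let $T_n$ be the test statistic based on the projections of $n$ independent copies of $\bm U$ onto this grid of points. Let $c_n\in(0,1)$ satisfy $c_n\to0$, $nc_n\to\infty$ and $nc_n^{1+2\delta}\to0$ as $n\to\infty$. Then $$T_n(c_n)\to_D\sum_{i=1}^{k-1}\lambda_i\xi_i^2\quad\text{as }n\to\infty,$$ where $\xi_1,\dots,\xi_{k-1}$ are independent standard normal random variables and $\lambda_i=\frac1{4\sin^2\left(\frac ik\frac\pi2\right)}$, $1\le i\le k-1$.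
   Context: $\to_D$ denotes convergence in distribution; operations and inequalities between functions are pointwise on $[0,1]$; $1_{[0,1]}$ is the constant function $1$ on $[0,1]$. $E[0,1]$ is the set of bounded functions $f:[0,1]\to\mathbb{R}$ with only finitely many discontinuities, $E^-[0,1]$ the subset of those attaining only non-positive values, and $\|f\|_\infty=\sup_{t\in[0,1]}|f(t)|$. A copula process is a stochastic process $\bm U=(U_t)_{t\in[0,1]}$ with each $U_t$ uniformly distributed on $(0,1)$; $\bm U\in C[0,1]$ means that it has continuous sample paths. A $D$-norm on $E[0,1]$ is a norm of the form $\|f\|_D=E\left(\sup_{t\in[0,1]}(|f(t)|Z_t)\right)$, $f\in E[0,1]$, where the generator process $\bm Z=(Z_t)_{t\in[0,1]}$ has sample paths in $C[0,1]$, $0\le Z_t\le q$ for all $t\in[0,1]$, for some $q\in\mathbb{R}$, and $E(Z_t)=1$ for all $t\in[0,1]$. Let $\bm U^{(1)},\dots,\bm U^{(n)}$ be independent copies of $\bm U$ and consider their projections $\bigl(U^{(i)}_{t_1^{(d_n)}},\dots,U^{(i)}_{t_{d_n}^{(d_n)}}\bigr)^\top$ onto the grid. For $0<c<1$ and $1\le j\le k$ let $$n_j(c):=\sum_{i=1}^n1_{(0,\infty)}\left(\sum_{r=1}^{d_n}1_{\left(-\frac cj,\infty\right)}\left(U^{(i)}_{t_r^{(d_n)}}-1\right)\right)$$ be the number of projections with at least one component exceeding $1-\frac cj$. The test statistic is $$T_n(c):=\frac{\sum_{j=1}^k\left(j\,n_j(c)-\frac1k\sum_{\ell=1}^k\ell\,n_\ell(c)\right)^2}{\frac1k\sum_{\ell=1}^k\ell\,n_\ell(c)}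 .$$ *)

theory Defs
  imports "HOL-Probability.Probability"
begin

text \<open>
  Functions on \<open>[0,1]\<close> are represented by total functions on the reals of which only the
  values on \<open>{0..1}\<close> are used; a process \<open>(X\<^sub>t)\<close> is a map \<open>X :: real \<Rightarrow> 'a \<Rightarrow> real\<close>,
  \<open>X t \<omega>\<close> being the value at time \<open>t \<in> {0..1}\<close>.
\<close>

definition E01 :: "(real \<Rightarrow> real) set" where
  "E01 = {f. bounded (f ` {0..1}) \<and>
             finite {t \<in> {0..1}. \<not> continuous (at t within {0..1}) f}}"

definition E01_nonpos :: "(real \<Rightarrow> real) set" where
  "E01_nonpos = {f \<in> E01. \<forall>t\<in>{0..1}. f t \<le> 0}"

definition sup_norm01 :: "(real \<Rightarrow> real) \<Rightarrow> real" where
  "sup_norm01 f = (SUP t\<in>{0..1}. \<bar>f t\<bar>)"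

definition continuous_paths :: "'a measure \<Rightarrow> (real \<Rightarrow> 'a \<Rightarrow> real) \<Rightarrow> bool" where
  "continuous_paths M X \<longleftrightarrow> (\<forall>\<omega>\<in>space M. continuous_on {0..1} (\<lambda>t. X t \<omega>))"

definition copula_process :: "'a measure \<Rightarrow> (real \<Rightarrow> 'a \<Rightarrow> real) \<Rightarrow> bool" where
  "copula_process M U \<longleftrightarrow> prob_space M \<and>
     (\<forall>t\<in>{0..1}. U t \<in> borel_measurable M \<and>
        distr M borel (U t) = uniform_measure lborel {0<..<1})"

definition generator_process :: "'a measure \<Rightarrow> (real \<Rightarrow> 'a \<Rightarrow> real) \<Rightarrow> bool" where
  "generator_process M Z \<longleftrightarrow> prob_space M \<and>
     (\<forall>t\<in>{0..1}. Z t \<in> borel_measurable M) \<and>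
     continuous_paths M Z \<and>
     (\<exists>q. \<forall>t\<in>{0..1}. \<forall>\<omega>\<in>space M. 0 \<le> Z t \<omega> \<and> Z t \<omega> \<le> q) \<and>
     (\<forall>t\<in>{0..1}. prob_space.expectation M (Z t) = 1)"

definition D_norm :: "'a measure \<Rightarrow> (real \<Rightarrow> 'a \<Rightarrow> real) \<Rightarrow> (real \<Rightarrow> real) \<Rightarrow> real" where
  "D_norm M Z f = prob_space.expectation M (\<lambda>\<omega>. SUP t\<in>{0..1}. \<bar>f t\<bar> * Z t \<omega>)"

text \<open>
  The constant \<open>K\<close> and the range of \<open>c\<close> are chosen before \<open>f\<close>: the remainder
  \<open>O(c powr (1 + \<delta>))\<close> is uniform in \<open>f\<close>.
\<close>

definition D_norm_expansion ::
  "'a measure \<Rightarrow> (real \<Rightarrow> 'a \<Rightarrow> real) \<Rightarrow> real \<Rightarrow> ((real \<Rightarrow> real) \<Rightarrow> real) \<Rightarrow> bool" where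
  "D_norm_expansion M U \<delta> nrm \<longleftrightarrow>
     (\<exists>K. \<forall>\<^sub>F c in at_right 0. \<forall>f\<in>E01_nonpos. sup_norm01 f \<le> 1 \<longrightarrow>
        \<bar>measure M {\<omega> \<in> space M. \<forall>t\<in>{0..1}. U t \<omega> \<le> 1 + c * f t} - (1 - c * nrm f)\<bar>
          \<le> K * c powr (1 + \<delta>))"

text \<open>
  A process as a random element of the product space over \<open>{0..1}\<close>, whose product
  sigma-algebra is generated by the coordinates. Copies have the same law there, that is, the
  same finite-dimensional distributions.
\<close>

definition process_path :: "(real \<Rightarrow> 'a \<Rightarrow> real) \<Rightarrow> 'a \<Rightarrow> real \<Rightarrow> real" where
  "process_path X \<omega> = (\<lambda>t\<in>{0..1}. X t \<omega>)"

abbreviation path_space :: "(real \<Rightarrow> real) measure" where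
  "path_space \<equiv> Pi\<^sub>M {0..1} (\<lambda>_. borel)"

definition independent_copies ::
  "'b measure \<Rightarrow> (nat \<Rightarrow> real \<Rightarrow> 'b \<Rightarrow> real) \<Rightarrow> 'a measure \<Rightarrow> (real \<Rightarrow> 'a \<Rightarrow> real) \<Rightarrow> bool" where
  "independent_copies N X M U \<longleftrightarrow> prob_space N \<and>
     prob_space.indep_vars N (\<lambda>_. path_space) (\<lambda>i. process_path (X i)) {1..} \<and>
     (\<forall>i\<ge>1. distr N path_space (process_path (X i)) = distr M path_space (process_path U))"

text \<open>
  Below, \<open>x 1, \<dots>, x n\<close> are observed functions (one realization of the sample) and
  \<open>s 1, \<dots>, s d\<close> are the grid points.
\<close>

definition exceedances ::
  "(nat \<Rightarrow> real \<Rightarrow> real) \<Rightarrow> nat \<Rightarrow> (nat \<Rightarrow> real) \<Rightarrow> nat \<Rightarrow> real \<Rightarrow> nat \<Rightarrow> real" where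
  "exceedances x n s d c j =
     (\<Sum>i=1..n. indicator {0::real<..}
        (\<Sum>r=1..d. indicator {- (c / real j)<..} (x i (s r) - 1)))"

definition test_statistic ::
  "nat \<Rightarrow> (nat \<Rightarrow> real \<Rightarrow> real) \<Rightarrow> nat \<Rightarrow> (nat \<Rightarrow> real) \<Rightarrow> nat \<Rightarrow> real \<Rightarrow> real" where
  "test_statistic k x n s d c =
     (let avg = (1 / real k) * (\<Sum>l=1..k. real l * exceedances x n s d c l)
      in (\<Sum>j=1..k. (real j * exceedances x n s d c j - avg)\<^sup>2) / avg)"

end

theory Submission
  imports Defs
begin

text \<open>
  Write \<open>x\<^sub>j = j n\<^sub>j(c\<^sub>n)\<close> and \<open>\<kappa>\<^sub>n = n c\<^sub>n m\<^sub>n\<close>, where \<open>m\<^sub>n \<ge> 1\<close> is the mean of the maximum of the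
  generator over the grid. Each \<open>n\<^sub>j\<close> counts successes of independent events, nested in \<open>j\<close>, of
  probability \<open>c\<^sub>n m\<^sub>n / j + O(c\<^sub>n powr (1 + \<delta>))\<close>; hence the vector of the \<open>x\<^sub>j / sqrt \<kappa>\<^sub>n\<close>, tested
  against weights of sum zero, is asymptotically centred Gaussian with covariance
  \<open>j l min (1/j) (1/l) = min j l\<close>, as for a random walk. The discrete cosine basis diagonalizes this
  form on the vectors of sum zero, with eigenvalues \<open>\<lambda>\<^sub>i\<close>, and by Parseval
  \<open>T\<^sub>n = (\<Sum>i. (F\<^sub>i)\<^sup>2) / A\<close>, where the \<open>F\<^sub>i\<close> are the cosine coefficients of \<open>x / sqrt \<kappa>\<^sub>n\<close> and \<open>A\<close>,
  the mean of \<open>x / \<kappa>\<^sub>n\<close>, tends to 1 in \<open>L\<^sup>1\<close>.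

  No multivariate continuity theorem is needed: integrating the Gaussian variables \<open>\<xi>\<^sub>i\<close> of the limit
  against \<open>F\<^sub>i\<close> gives \<open>exp (- s (\<Sum>i. (F\<^sub>i)\<^sup>2)) = E\<^sub>\<xi> exp (\<i> sqrt (2 s) (\<Sum>i. \<xi>\<^sub>i F\<^sub>i))\<close>, so that by Fubini
  pointwise convergence of the characteristic functions of the linear forms in \<open>F\<close> yields
  convergence of Laplace transforms.
\<close>

section \<open>Laplace transforms and weak convergence\<close>

text \<open>By Stone-Weierstrass, polynomials in \<open>exp (- z)\<close> are uniformly dense among
  the continuous functions on the half line that have a limit at infinity, and the continuous steps
  that test weak convergence are of this kind. The monomials are Laplace kernels with integer
  \<open>s\<close>, so these suffice. Uniformity up to infinity also covers mass that might
  escape.\<close>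

lemma laplace_convergence_imp_weak_conv:
  fixes \<mu> :: "nat \<Rightarrow> real measure" and \<nu> :: "real measure"
  assumes \<mu>: "\<And>n. real_distribution (\<mu> n)" and \<nu>: "real_distribution \<nu>"
    and \<mu>_nonneg: "\<And>n. AE x in \<mu> n. 0 \<le> x" and \<nu>_nonneg: "AE x in \<nu>. 0 \<le> x"
    and laplace: "\<And>s::nat. (\<lambda>n. \<integral>x. exp (- (real s * x)) \<partial>\<mu> n) \<longlonglongrightarrow> (\<integral>x. exp (- (real s * x)) \<partial>\<nu>)"
  shows "weak_conv_m \<mu> \<nu>"
proof (rule integral_cts_step_conv_imp_weak_conv[OF \<mu> \<nu>])
  fix x y :: real
  assume xy: "x < y"
  \<comment> \<open>In the variable \<open>w = exp (- z)\<close> the step extends continuously by 0 to \<open>w = 0\<close>, and polynomials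
    in \<open>w\<close> are combinations of Laplace kernels.\<close>
  define h where "h w = (if w \<le> 0 then 0 else cts_step x y (- ln w))" for w
  have step_cont: "continuous_on UNIV (cts_step x y)"
    using cts_step_uniformly_continuous[OF xy] by (rule uniformly_continuous_imp_continuous)
  \<comment> \<open>The two open sets overlap: for \<open>0 < w < exp (- y)\<close> the argument
    \<open>- ln w\<close> exceeds \<open>y\<close>, where the step has already dropped to 0, so the
    value 0 chosen for \<open>w \<le> 0\<close> fits continuously.\<close>
  have "continuous_on ({..<exp (- y)} \<union> {0<..}) h"
  proof (rule continuous_on_open_Un)
    have "h w = 0" if "w \<in> {..<exp (- y)}" for w
    proof (cases "w \<le> 0")
      case False
      then have "ln w < - y"
        using that by (metis exp_less_cancel_iff exp_ln lessThan_iff not_le)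
      then show ?thesis
        using False xy by (simp add: h_def cts_step_def)
    qed (simp add: h_def)
    then show "continuous_on {..<exp (- y)} h"
      by (metis (mono_tags, lifting) continuous_on_cong continuous_on_const)
  next
    have "continuous_on {0<..} (\<lambda>w. cts_step x y (- ln w))"
      by (rule continuous_on_compose2[OF step_cont]) (auto intro!: continuous_intros)
    then show "continuous_on {0<..} h"
      by (rule continuous_on_eq) (auto simp: h_def)
  qed auto
  moreover have "{0..1} \<subseteq> {..<exp (- y)} \<union> {0<..}"
    by (auto simp: not_less)
  ultimately have h_cont: "continuous_on {0..1} h"
    by (rule continuous_on_subset)
  show "(\<lambda>n. integral\<^sup>L (\<mu> n) (cts_step x y)) \<longlonglongrightarrow> integral\<^sup>L \<nu> (cts_step x y)"
  proof (rule LIMSEQ_I)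
    fix e :: real
    assume "0 < e"
    \<comment> \<open>One third each for replacing the step by the polynomial under
      \<open>\<mu> n\<close> and under \<open>\<nu>\<close>, and one for the convergence of the
      integrals of the polynomial.\<close>
    then have e: "0 < e / 3"
      by simp
    obtain g where g: "real_polynomial_function g" "\<And>w. w \<in> {0..1} \<Longrightarrow> \<bar>h w - g w\<bar> < e / 3"
      using Stone_Weierstrass_real_polynomial_function[OF compact_Icc h_cont e] by blast
    obtain a m where g_eq: "g = (\<lambda>w. \<Sum>i\<le>m. a i * w ^ i)"
      using g(1) by (metis real_polynomial_function_iff_sum)
    define p where "p z = (\<Sum>i\<le>m. a i * exp (- (real i * z)))" for z
    have p_near: "\<bar>cts_step x y z - p z\<bar> \<le> e / 3" if "0 \<le> z" for z
    proof -
      have "p z = g (exp (- z))"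
        unfolding p_def g_eq by (simp add: exp_of_nat_mult[symmetric])
      moreover have "cts_step x y z = h (exp (- z))"
        by (simp add: h_def)
      ultimately show ?thesis
        using g(2)[of "exp (- z)"] that by simp
    qed
    have p: "integral\<^sup>L \<kappa> p = (\<Sum>i\<le>m. a i * (\<integral>z. exp (- (real i * z)) \<partial>\<kappa>))"
      "\<bar>integral\<^sup>L \<kappa> (cts_step x y) - integral\<^sup>L \<kappa> p\<bar> \<le> e / 3"
      if \<kappa>: "real_distribution \<kappa>" "AE z in \<kappa>. 0 \<le> z" for \<kappa> :: "real measure"
    proof -
      interpret real_distribution \<kappa> by fact
      have int: "integrable \<kappa> (\<lambda>z. exp (- (real i * z)))" for i
        by (rule integrable_const_bound[where B = 1]) (use \<kappa>(2) in \<open>auto simp: mult_nonneg_nonneg\<close>)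
      then show "integral\<^sup>L \<kappa> p = (\<Sum>i\<le>m. a i * (\<integral>z. exp (- (real i * z)) \<partial>\<kappa>))"
        by (simp add: p_def[abs_def])
      have int_p: "integrable \<kappa> p"
        unfolding p_def[abs_def] using int by auto
      note int_step = integrable_cts_step[OF xy]
      have "\<bar>integral\<^sup>L \<kappa> (cts_step x y) - integral\<^sup>L \<kappa> p\<bar> = \<bar>\<integral>z. cts_step x y z - p z \<partial>\<kappa>\<bar>"
        using int_p int_step by simp
      also have "\<dots> \<le> (\<integral>z. \<bar>cts_step x y z - p z\<bar> \<partial>\<kappa>)"
        by (rule integral_abs_bound)
      also have "\<dots> \<le> e / 3"
        by (rule integral_le_const) (use int_p int_step \<kappa>(2) p_near in auto)
      finally show "\<bar>integral\<^sup>L \<kappa> (cts_step x y) - integral\<^sup>L \<kappa> p\<bar> \<le> e / 3" .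
    qed
    have "(\<lambda>n. integral\<^sup>L (\<mu> n) p) \<longlonglongrightarrow> integral\<^sup>L \<nu> p"
      unfolding p(1)[OF \<mu> \<mu>_nonneg] p(1)[OF \<nu> \<nu>_nonneg]
      by (intro tendsto_intros laplace)
    then obtain n0 where n0: "\<And>n. n \<ge> n0 \<Longrightarrow> \<bar>integral\<^sup>L (\<mu> n) p - integral\<^sup>L \<nu> p\<bar> < e / 3"
      using LIMSEQ_D[OF _ e] by (metis real_norm_def)
    have "norm (integral\<^sup>L (\<mu> n) (cts_step x y) - integral\<^sup>L \<nu> (cts_step x y)) < e" if "n \<ge> n0" for n
      using n0[OF that] p(2)[OF \<mu> \<mu>_nonneg, of n] p(2)[OF \<nu> \<nu>_nonneg]
      unfolding real_norm_def by linarith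
    then show "\<exists>n0. \<forall>n\<ge>n0. norm (integral\<^sup>L (\<mu> n) (cts_step x y) - integral\<^sup>L \<nu> (cts_step x y)) < e"
      by blast
  qed
qed

text \<open>Includes \<open>a = 0\<close>, where \<open>x / a = 0\<close>.\<close>

lemma abs_exp_divide_diff_le:
  fixes a x :: real
  assumes x: "0 \<le> x" and a: "0 \<le> a"
  shows "\<bar>exp (- (x / a)) - exp (- x)\<bar> \<le> 2 * \<bar>a - 1\<bar>"
proof (cases "a = 0")
  case True
  then show ?thesis
    using x exp_gt_zero[of "- x"] by (simp add: abs_le_iff del: exp_gt_zero)
next
  case False
  define y where "y = x / a"
  have pos: "0 < a" "0 \<le> y" and x_eq: "x = y * a"
    using False a x by (auto simp: y_def)
  have y_exp: "z * exp (- z) \<le> 1" for z :: real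
  proof -
    have "z \<le> exp z"
      using exp_ge_add_one_self[of z] by linarith
    then show ?thesis
      by (simp add: exp_minus field_simps)
  qed
  show ?thesis
  proof (cases "1 \<le> a")
    case True
    have "exp (- y) - exp (- x) = exp (- y) * (1 - exp (- (y * (a - 1))))"
      by (simp add: x_eq algebra_simps flip: exp_add)
    also have "\<dots> \<le> exp (- y) * (y * (a - 1))"
      using exp_ge_add_one_self[of "- (y * (a - 1))"] by (intro mult_left_mono) (linarith, simp)
    also have "\<dots> \<le> 1 * (a - 1)"
      using mult_right_mono[OF y_exp[of y], of "a - 1"] True by (simp add: mult_ac)
    finally have "exp (- y) - exp (- x) \<le> a - 1" by simp
    moreover have "exp (- x) \<le> exp (- y)"
      using True pos(2) by (simp add: x_eq mult_le_cancel_left1)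
    ultimately show ?thesis
      using True by (simp add: y_def)
  next
    \<comment> \<open>Let \<open>D\<close> be \<open>exp (- x) - exp (- y)\<close>. To avoid
      dividing by a small \<open>a\<close>, two bounds are added: \<open>a * D \<le> 1 - a\<close>,
      because \<open>x * exp (- x) \<le> 1\<close>, and \<open>(1 - a) * D \<le> 1 - a\<close>,
      because \<open>D \<le> 1\<close>. This is the origin of the factor 2.\<close>
    case False
    have *: "exp (- x) - exp (- y) = exp (- x) * (1 - exp (- (y * (1 - a))))"
      by (simp add: x_eq algebra_simps flip: exp_add)
    also have "\<dots> \<le> exp (- x) * (y * (1 - a))"
      using exp_ge_add_one_self[of "- (y * (1 - a))"] by (intro mult_left_mono) (linarith, simp)
    finally have "a * (exp (- x) - exp (- y)) \<le> a * (exp (- x) * (y * (1 - a)))"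
      using pos by simp
    also have "\<dots> = (x * exp (- x)) * (1 - a)"
      by (simp add: x_eq)
    also have "\<dots> \<le> 1 * (1 - a)"
      using False by (intro mult_right_mono y_exp) auto
    finally have 1: "a * (exp (- x) - exp (- y)) \<le> 1 - a" by simp
    have ge: "exp (- y) \<le> exp (- x)"
      using False pos by (simp add: x_eq mult_left_le)
    have 2: "exp (- x) - exp (- y) \<le> 1"
      using x exp_gt_zero[of "- y"] exp_le_one_iff[of "-x"] by linarith
    have "(1 - a) * (exp (- x) - exp (- y)) \<le> (1 - a) * 1"
      using False 2 by (intro mult_left_mono) auto
    with 1 have "exp (- x) - exp (- y) \<le> 2 * (1 - a)"
      by (simp add: algebra_simps)
    then show ?thesis
      using False ge by (simp add: y_def)
  qed
qed

section \<open>The discrete cosine basis and the form \<open>min j l\<close>\<close>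

text \<open>A Dirichlet kernel: multiplied by \<open>2 * sin \<theta>\<close>, with \<theta> half of
  the angular step, the sum telescopes. The divisibility assumption says exactly that
  \<open>sin \<theta>\<close> is nonzero.\<close>

lemma cos_sum_half_period:
  fixes m :: int
  assumes k: "1 \<le> k" and m: "\<not> 2 * int k dvd m"
  shows "(\<Sum>i=1..k - 1. cos (of_int m * real i * pi / real k)) = (if even m then - 1 else 0)"
proof -
  define \<theta> where "\<theta> = of_int m * pi / (2 * real k)"
  have s: "sin \<theta> \<noteq> 0"
  proof
    assume "sin \<theta> = 0"
    then obtain j :: int where "\<theta> = of_int j * pi"
      by (auto simp: sin_zero_iff_int2)
    then have "real_of_int m = of_int (2 * int k * j)"
      using k by (simp add: \<theta>_def field_simps)
    then have "m = 2 * int k * j"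
      by linarith
    with m show False
      by simp
  qed
  have tele: "2 * sin \<theta> * (\<Sum>i=1..n. cos (2 * real i * \<theta>)) = sin ((2 * real n + 1) * \<theta>) - sin \<theta>" for n
  proof (induction n)
    case (Suc n)
    have "2 * sin \<theta> * cos (2 * real (Suc n) * \<theta>) = sin ((2 * real (Suc n) + 1) * \<theta>) - sin ((2 * real n + 1) * \<theta>)"
      using sin_diff[of "2 * real (Suc n) * \<theta>" \<theta>] sin_add[of "2 * real (Suc n) * \<theta>" \<theta>]
      by (simp add: algebra_simps)
    then show ?case
      using Suc by (simp add: algebra_simps)
  qed simp
  \<comment> \<open>The upper end of the telescope falls one half step short of a multiple of pi, so
    only the parity of \<open>m\<close> survives.\<close>
  have "(2 * real (k - 1) + 1) * \<theta> = of_int m * pi - \<theta>"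
    using k by (simp add: \<theta>_def of_nat_diff field_simps)
  then have "2 * sin \<theta> * (\<Sum>i=1..k - 1. cos (2 * real i * \<theta>)) = - (cos (of_int m * pi) * sin \<theta>) - sin \<theta>"
    unfolding tele by (simp add: sin_diff mult.commute[of _ pi])
  also have "cos (of_int m * pi) = (if even m then 1 else - 1)"
    by (simp add: mult.commute)
  finally have "sin \<theta> * (\<Sum>i=1..k - 1. cos (2 * real i * \<theta>)) = sin \<theta> * (if even m then - 1 else 0)"
    by (cases "even m"; simp only: if_True if_False simp_thms; linarith)
  then have "(\<Sum>i=1..k - 1. cos (2 * real i * \<theta>)) = (if even m then - 1 else 0)"
    using s by (simp only: mult_cancel_left simp_thms)
  moreover have "2 * real i * \<theta> = of_int m * real i * pi / real k" for i
    using k by (simp add: \<theta>_def)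
  ultimately show ?thesis
    by simp
qed

text \<open>The type-II discrete cosine transform, with \<open>j\<close> counted from 1; the vectors with \<open>1 \<le> i < k\<close>
  are an orthonormal basis of the vectors of sum zero.\<close>

definition dct :: "nat \<Rightarrow> nat \<Rightarrow> nat \<Rightarrow> real" where
  "dct k i j = sqrt (2 / real k) * cos ((2 * real j - 1) * real i * pi / (2 * real k))"

text \<open>The right side is the projection onto the complement of the constant vectors.
  Product-to-sum formulas turn the left side into half-period cosine sums at the frequencies
  \<open>j - l\<close> and \<open>j + l - 1\<close>. Off the diagonal these have opposite parity, so
  exactly one of the two sums is -1 and the other is 0.\<close>

lemma dct_completeness:
  assumes "j \<in> {1..k}" "l \<in> {1..k}"
  shows "(\<Sum>i=1..k - 1. dct k i j * dct k i l) = (if j = l then 1 else 0) - 1 / real k"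
proof -
  have k: "1 \<le> k"
    using assms by auto
  define C where "C m = (\<Sum>i=1..k - 1. cos (of_int m * real i * pi / real k))" for m :: int
  let ?m = "int j - int l" and ?n = "int j + int l - 1"
  have "dct k i j * dct k i l =
      (cos (of_int ?m * real i * pi / real k) + cos (of_int ?n * real i * pi / real k)) / real k" for i
  proof -
    let ?a = "(2 * real j - 1) * real i * pi / (2 * real k)"
      and ?b = "(2 * real l - 1) * real i * pi / (2 * real k)"
    have "?a - ?b = of_int ?m * real i * pi / real k" "?a + ?b = of_int ?n * real i * pi / real k"
      using k by (simp_all add: field_simps)
    moreover have "dct k i j * dct k i l = (sqrt (2 / real k) * sqrt (2 / real k)) * (cos ?a * cos ?b)"
      by (simp only: dct_def mult_ac)
    moreover have "cos ?a * cos ?b = (cos (?a - ?b) + cos (?a + ?b)) / 2"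
      by (simp only: cos_diff cos_add) simp
    ultimately show ?thesis
      by (simp add: add_divide_distrib)
  qed
  then have sum: "(\<Sum>i=1..k - 1. dct k i j * dct k i l) = (C ?m + C ?n) / real k"
    by (simp only: C_def sum_divide_distrib flip: sum.distrib)
  have n: "\<not> 2 * int k dvd ?n"
    using assms by (auto dest!: zdvd_imp_le)
  show ?thesis
  proof (cases "j = l")
    case True
    then have "C ?m = real k - 1" "C ?n = 0"
      using cos_sum_half_period[OF k n] k by (simp_all add: C_def of_nat_diff)
    then show ?thesis
      using sum True k by (simp add: field_simps)
  next
    case False
    then have m: "\<not> 2 * int k dvd ?m"
      using assms dvd_imp_le_int[of ?m "2 * int k"] by auto
    have "even ?n \<longleftrightarrow> odd ?m"
      by simp
    then have "C ?m + C ?n = - 1"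
      using cos_sum_half_period[OF k m] cos_sum_half_period[OF k n] by (simp add: C_def)
    then show ?thesis
      using sum False by simp
  qed
qed

text \<open>Parseval's identity for the projection that removes the mean. With \<open>x j\<close>
  equal to \<open>j\<close> times the \<open>j\<close>-th count, the right side is the numerator of
  the test statistic.\<close>

lemma dct_parseval:
  "(\<Sum>i=1..k - 1. (\<Sum>j=1..k. dct k i j * x j)\<^sup>2) = (\<Sum>j=1..k. (x j - (\<Sum>l=1..k. x l) / real k)\<^sup>2)"
proof (cases "k = 0")
  case False
  let ?S = "\<Sum>l=1..k. x l"
  have "(\<Sum>i=1..k - 1. (\<Sum>j=1..k. dct k i j * x j)\<^sup>2) =
      (\<Sum>i=1..k - 1. \<Sum>j=1..k. \<Sum>l=1..k. x j * x l * (dct k i j * dct k i l))"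
    by (simp add: power2_eq_square sum_product mult_ac)
  also have "\<dots> = (\<Sum>j=1..k. \<Sum>l=1..k. x j * x l * (\<Sum>i=1..k - 1. dct k i j * dct k i l))"
    by (subst sum.swap, rule sum.cong[OF refl], subst sum.swap, simp only: sum_distrib_left)
  also have "\<dots> = (\<Sum>j=1..k. \<Sum>l=1..k. (if j = l then x j * x l else 0) - x j * x l / real k)"
    by (intro sum.cong refl, subst dct_completeness) (auto simp: algebra_simps)
  also have "\<dots> = (\<Sum>j=1..k. (x j)\<^sup>2) - ?S\<^sup>2 / real k"
    by (simp add: sum_subtractf sum_divide_distrib[symmetric] power2_eq_square sum_product)
  also have "\<dots> = (\<Sum>j=1..k. (x j - ?S / real k)\<^sup>2)"
    using False
    by (simp add: power2_diff sum.distrib sum_subtractf sum_distrib_left[symmetric] sum_divide_distrib[symmetric] sum_distrib_right[symmetric])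
      (simp add: field_simps power2_eq_square)
  finally show ?thesis .
qed simp

text \<open>Tail summation is the operator that factorizes the form \<open>min j l\<close>; it maps
  each cosine vector to a multiple of a sine vector, and the reciprocal of \<open>2 * sin\<close> in
  that multiple is the square root of the eigenvalue. The sum telescopes as for the cosine sums
  above.\<close>

lemma dct_tail_sum:
  assumes i: "i \<in> {1..k - 1}" and r: "r \<le> k"
  shows "(\<Sum>j=Suc r..k. dct k i j) =
    - (sqrt (2 / real k) * sin (real r * real i * pi / real k) / (2 * sin (real i * pi / (2 * real k))))"
proof -
  define \<theta> where "\<theta> = real i * pi / (2 * real k)"
  have k: "1 \<le> k"
    using i by auto
  have "0 < \<theta>" "\<theta> < pi"
    using i k by (auto simp: \<theta>_def field_simps)
  then have s: "sin \<theta> > 0"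
    by (rule sin_gt_zero)
  have tele: "2 * sin \<theta> * (\<Sum>j=Suc r..r + n. cos ((2 * real j - 1) * \<theta>)) =
      sin (2 * real (r + n) * \<theta>) - sin (2 * real r * \<theta>)" for n
  proof (induction n)
    case (Suc n)
    let ?b = "(2 * real (Suc (r + n)) - 1) * \<theta>"
    have "2 * sin \<theta> * cos ?b = sin (2 * real (Suc (r + n)) * \<theta>) - sin (2 * real (r + n) * \<theta>)"
      using sin_diff[of ?b \<theta>] sin_add[of ?b \<theta>] by (simp add: algebra_simps)
    then show ?case
      using Suc by (simp add: algebra_simps)
  qed simp
  have "2 * real k * \<theta> = real i * pi"
    using k by (simp add: \<theta>_def)
  then have "2 * sin \<theta> * (\<Sum>j=Suc r..k. cos ((2 * real j - 1) * \<theta>)) = - sin (2 * real r * \<theta>)"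
    using tele[of "k - r"] r by simp
  then have "(\<Sum>j=Suc r..k. cos ((2 * real j - 1) * \<theta>)) = - sin (2 * real r * \<theta>) / (2 * sin \<theta>)"
    using s by (simp add: field_simps)
  moreover have "(\<Sum>j=Suc r..k. dct k i j) = sqrt (2 / real k) * (\<Sum>j=Suc r..k. cos ((2 * real j - 1) * \<theta>))"
    unfolding sum_distrib_left dct_def \<theta>_def by (simp add: mult_ac)
  moreover have "2 * real r * \<theta> = real r * real i * pi / real k"
    by (simp add: \<theta>_def)
  ultimately show ?thesis
    by (simp add: \<theta>_def mult.assoc)
qed

lemma dct_sum_eq_0: "i \<in> {1..k - 1} \<Longrightarrow> (\<Sum>j=1..k. dct k i j) = 0"
  using dct_tail_sum[of i k 0] by simp

text \<open>The term \<open>r = 0\<close> vanishes, which leaves half-period cosine sums at the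
  frequencies \<open>i - i'\<close> and \<open>i + i'\<close>. These have equal parity, so they
  cancel unless \<open>i = i'\<close>, where the first sum consists of \<open>k - 1\<close>
  ones.\<close>

lemma sin_sum_orthogonal:
  assumes i: "i \<in> {1..k - 1}" and i': "i' \<in> {1..k - 1}"
  shows "(\<Sum>r<k. sin (real r * real i * pi / real k) * sin (real r * real i' * pi / real k)) =
    (if i = i' then real k / 2 else 0)"
proof -
  have k: "1 \<le> k"
    using i by auto
  define C where "C m = (\<Sum>r=1..k - 1. cos (of_int m * real r * pi / real k))" for m :: int
  let ?m = "int i - int i'" and ?n = "int i + int i'"
  have "sin (real r * real i * pi / real k) * sin (real r * real i' * pi / real k) =
      (cos (of_int ?m * real r * pi / real k) - cos (of_int ?n * real r * pi / real k)) / 2" for r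
  proof -
    let ?a = "real r * real i * pi / real k" and ?b = "real r * real i' * pi / real k"
    have "?a - ?b = of_int ?m * real r * pi / real k" "?a + ?b = of_int ?n * real r * pi / real k"
      using k by (simp_all add: field_simps)
    moreover have "sin ?a * sin ?b = (cos (?a - ?b) - cos (?a + ?b)) / 2"
      by (simp add: cos_diff cos_add)
    ultimately show ?thesis
      by simp
  qed
  then have "(\<Sum>r=1..k - 1. sin (real r * real i * pi / real k) * sin (real r * real i' * pi / real k)) =
      (C ?m - C ?n) / 2"
    by (simp only: C_def sum_divide_distrib flip: sum_subtractf)
  moreover have "{..<k} = insert 0 {1..k - 1}"
    using k by auto
  ultimately have sum: "(\<Sum>r<k. sin (real r * real i * pi / real k) * sin (real r * real i' * pi / real k)) =
      (C ?m - C ?n) / 2"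
    by simp
  have n: "\<not> 2 * int k dvd ?n"
    using i i' by (auto dest!: zdvd_imp_le)
  show ?thesis
  proof (cases "i = i'")
    case True
    then have "C ?m = real k - 1" "C ?n = - 1"
      using cos_sum_half_period[OF k n] k by (simp_all add: C_def of_nat_diff)
    then show ?thesis
      using sum True by simp
  next
    case False
    then have m: "\<not> 2 * int k dvd ?m"
      using i i' dvd_imp_le_int[of ?m "2 * int k"] by auto
    have "even ?n \<longleftrightarrow> even ?m"
      by simp
    then have "C ?m = C ?n"
      using cos_sum_half_period[OF k m] cos_sum_half_period[OF k n] by (simp add: C_def)
    then show ?thesis
      using sum False by simp
  qed
qed

text \<open>\<open>min j l\<close> is the number of \<open>r\<close> below both \<open>j\<close> and
  \<open>l\<close>. Exchanging sums then decomposes the form over the increments of a random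
  walk.\<close>

lemma sum_min_eq_tail_sums:
  fixes u v :: "nat \<Rightarrow> real"
  shows "(\<Sum>j=1..k. \<Sum>l=1..k. u j * v l * real (min j l)) =
    (\<Sum>r<k. (\<Sum>j=Suc r..k. u j) * (\<Sum>l=Suc r..k. v l))"
proof -
  have min_eq: "real (min j l) = (\<Sum>r<k. of_bool (r < j) * of_bool (r < l))"
    if "j \<le> k" "l \<le> k" for j l
  proof -
    have "(\<Sum>r<k. of_bool (r < j) * of_bool (r < l)) = (\<Sum>r<k. if r < min j l then 1 else (0::real))"
      by (intro sum.cong) auto
    also have "\<dots> = real (card {r. r < k \<and> r < min j l})"
      by (simp add: sum.If_cases Int_def lessThan_def)
    also have "{r. r < k \<and> r < min j l} = {..<min j l}"
      using that by auto
    finally show ?thesis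
      by simp
  qed
  have tail: "(\<Sum>j=Suc r..k. w j) = (\<Sum>j=1..k. w j * of_bool (r < j))" for r and w :: "nat \<Rightarrow> real"
    by (rule sum.mono_neutral_cong_left) auto
  have "(\<Sum>j=1..k. \<Sum>l=1..k. u j * v l * real (min j l)) =
      (\<Sum>j=1..k. \<Sum>l=1..k. \<Sum>r<k. (u j * of_bool (r < j)) * (v l * of_bool (r < l)))"
    by (rule sum.cong[OF refl], rule sum.cong[OF refl], subst min_eq)
      (simp_all only: sum_distrib_left mult_ac atLeastAtMost_iff)
  also have "\<dots> = (\<Sum>j=1..k. \<Sum>r<k. \<Sum>l=1..k. (u j * of_bool (r < j)) * (v l * of_bool (r < l)))"
    by (rule sum.cong[OF refl], rule sum.swap)
  also have "\<dots> = (\<Sum>r<k. \<Sum>j=1..k. \<Sum>l=1..k. (u j * of_bool (r < j)) * (v l * of_bool (r < l)))"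
    by (rule sum.swap)
  also have "\<dots> = (\<Sum>r<k. (\<Sum>j=Suc r..k. u j) * (\<Sum>l=Suc r..k. v l))"
    by (rule sum.cong[OF refl], subst tail[of u], subst tail[of v], simp only: sum_product)
  finally show ?thesis .
qed

text \<open>Tail sums carry the form to the Euclidean product of sine vectors, which are orthogonal.
  The factor \<open>2 / k\<close> from normalizing the cosines cancels the squared length
  \<open>k / 2\<close> of the sines, and the squared factor from the tail sums remains.\<close>

lemma dct_diagonalizes_min:
  assumes i: "i \<in> {1..k - 1}" and i': "i' \<in> {1..k - 1}"
  shows "(\<Sum>j=1..k. \<Sum>l=1..k. dct k i j * dct k i' l * real (min j l)) =
    (if i = i' then 1 / (4 * (sin (real i / real k * (pi / 2)))\<^sup>2) else 0)"
proof -
  have k: "1 \<le> k"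
    using i by auto
  let ?s = "\<lambda>i. sin (real i * pi / (2 * real k))"
  have "(\<Sum>j=1..k. \<Sum>l=1..k. dct k i j * dct k i' l * real (min j l)) =
      (\<Sum>r<k. (2 / real k) / (4 * ?s i * ?s i') *
        (sin (real r * real i * pi / real k) * sin (real r * real i' * pi / real k)))"
    unfolding sum_min_eq_tail_sums
  proof (rule sum.cong[OF refl])
    fix r
    assume "r \<in> {..<k}"
    then have r: "r \<le> k"
      by simp
    have *: "- (c * x / (2 * a)) * - (c * y / (2 * b)) = (c * c) / (4 * a * b) * (x * y)" for a b c x y :: real
      by (simp add: mult_ac)
    show "(\<Sum>j=Suc r..k. dct k i j) * (\<Sum>l=Suc r..k. dct k i' l) = (2 / real k) / (4 * ?s i * ?s i') *
        (sin (real r * real i * pi / real k) * sin (real r * real i' * pi / real k))"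
      unfolding dct_tail_sum[OF i r] dct_tail_sum[OF i' r] * by simp
  qed
  also have "\<dots> = (if i = i' then 1 / (4 * ?s i * ?s i') else 0)"
    unfolding sum_distrib_left[symmetric] sin_sum_orthogonal[OF i i'] using k by simp
  finally show ?thesis
    by (simp add: power2_eq_square mult.commute mult.left_commute)
qed


text \<open>Supplies the limiting variance of the linear form with coefficients \<open>a i\<close>
  in the cosine coefficients of the rescaled counts.\<close>

lemma min_form_dct_combination:
  fixes a :: "nat \<Rightarrow> real" and k :: nat
  defines "w \<equiv> \<lambda>j. \<Sum>i=1..k - 1. a i * dct k i j"
  shows "(\<Sum>j=1..k. \<Sum>l=1..k. w j * w l * real (min j l)) =
    (\<Sum>i=1..k - 1. 1 / (4 * (sin (real i / real k * (pi / 2)))\<^sup>2) * (a i)\<^sup>2)"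
proof -
  have "(\<Sum>j=1..k. \<Sum>l=1..k. w j * w l * real (min j l)) =
      (\<Sum>j=1..k. \<Sum>l=1..k. \<Sum>i=1..k - 1. \<Sum>i'=1..k - 1.
        a i * a i' * (dct k i j * dct k i' l * real (min j l)))"
    unfolding w_def sum_product
    by (simp only: sum_distrib_left sum_distrib_right mult_ac)
  also have "\<dots> = (\<Sum>j=1..k. \<Sum>i=1..k - 1. \<Sum>i'=1..k - 1. \<Sum>l=1..k.
        a i * a i' * (dct k i j * dct k i' l * real (min j l)))"
    by (rule sum.cong[OF refl], subst sum.swap, rule sum.cong[OF refl], rule sum.swap)
  also have "\<dots> = (\<Sum>i=1..k - 1. \<Sum>i'=1..k - 1. \<Sum>j=1..k. \<Sum>l=1..k.
        a i * a i' * (dct k i j * dct k i' l * real (min j l)))"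
    by (subst sum.swap, rule sum.cong[OF refl], rule sum.swap)
  also have "\<dots> = (\<Sum>i=1..k - 1. \<Sum>i'=1..k - 1.
        a i * a i' * (if i = i' then 1 / (4 * (sin (real i / real k * (pi / 2)))\<^sup>2) else 0))"
    by (rule sum.cong[OF refl], rule sum.cong[OF refl], subst dct_diagonalizes_min[symmetric], assumption+, simp only: sum_distrib_left)
  also have "\<dots> = (\<Sum>i=1..k - 1. 1 / (4 * (sin (real i / real k * (pi / 2)))\<^sup>2) * (a i)\<^sup>2)"
    by (intro sum.cong refl) (simp add: if_distrib[of "(*) _"] power2_eq_square mult_ac cong: if_cong)
  finally show ?thesis .
qed

section \<open>Triangular arrays and Gaussian mixtures\<close>

text \<open>Both \<open>\<phi> n\<close> and \<open>exp (z / n)\<close> lie in the closed unit disc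
  for large \<open>n\<close>, so their \<open>n\<close>-th powers differ by at most \<open>n\<close>
  times the distance of the bases. That tends to 0 because both bases agree to first order in
  \<open>1 / n\<close>. No complex logarithm enters.\<close>

lemma tendsto_power_exp:
  fixes \<phi> :: "nat \<Rightarrow> complex"
  assumes le1: "\<forall>\<^sub>F n in sequentially. norm (\<phi> n) \<le> 1"
    and lim: "(\<lambda>n. of_nat n * (\<phi> n - 1)) \<longlonglongrightarrow> z" and z: "Re z \<le> 0"
  shows "(\<lambda>n. \<phi> n ^ n) \<longlonglongrightarrow> exp z"
proof -
  \<comment> \<open>The difference quotient at 0, taken along \<open>h = 1 / n\<close>, gives
    \<open>n * (exp (z / n) - 1)\<close>.\<close>
  have "((\<lambda>h. exp (h * z)) has_field_derivative z) (at 0)"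
    by (auto intro!: derivative_eq_intros)
  then have "((\<lambda>h. (exp (h * z) - 1) / h) \<longlongrightarrow> z) (at (0::complex))"
    by (simp add: DERIV_def)
  moreover have "filterlim (\<lambda>n. 1 / of_nat n :: complex) (at 0) sequentially"
    by (intro filterlim_atI) (auto simp: lim_1_over_n intro!: eventually_sequentiallyI[of 1])
  ultimately have "(\<lambda>n. (exp (1 / of_nat n * z) - 1) / (1 / of_nat n)) \<longlonglongrightarrow> z"
    by (rule filterlim_compose)
  then have exp_lim: "(\<lambda>n. of_nat n * (exp (z / of_nat n) - 1)) \<longlonglongrightarrow> z"
    by (simp add: mult.commute)
  have "(\<lambda>n. of_nat n * (\<phi> n - 1) - of_nat n * (exp (z / of_nat n) - 1)) \<longlonglongrightarrow> z - z"
    by (intro tendsto_diff lim exp_lim)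
  then have "(\<lambda>n. norm (of_nat n * (\<phi> n - exp (z / of_nat n)))) \<longlonglongrightarrow> 0"
    by (simp add: tendsto_norm_zero flip: right_diff_distrib)
  then have "(\<lambda>n. \<phi> n ^ n - exp z) \<longlonglongrightarrow> 0"
  proof (rule Lim_null_comparison[rotated])
    show "\<forall>\<^sub>F n in sequentially. norm (\<phi> n ^ n - exp z) \<le> norm (of_nat n * (\<phi> n - exp (z / of_nat n)))"
      using le1 eventually_ge_at_top[of 1]
    proof eventually_elim
      case (elim n)
      have "exp z = exp (z / of_nat n) ^ n"
        using elim by (simp flip: exp_of_nat_mult)
      moreover have "norm (exp (z / of_nat n)) \<le> 1"
        using z elim by (simp add: norm_exp_eq_Re Re_divide_of_nat divide_nonpos_nonneg)
      ultimately show ?case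
        using norm_power_diff[of "\<phi> n" "exp (z / of_nat n)" n] elim by (simp add: norm_mult)
    qed
  qed
  then show ?thesis
    by (simp add: LIM_zero_iff)
qed

text \<open>The Taylor remainder is at most one sixth of the third absolute moment, and boundedness
  trades one factor for \<open>B\<close>. The argument 1 is enough because scaling is put into the
  variable.\<close>

lemma (in real_distribution) char_one_second_order:
  assumes bound: "AE x in M. \<bar>x\<bar> \<le> B"
  shows "norm (char M 1 - (1 + \<i> * expectation (\<lambda>x. x) - expectation (\<lambda>x. x\<^sup>2) / 2)) \<le>
    B * expectation (\<lambda>x. x\<^sup>2) / 6"
proof -
  have int: "integrable M (\<lambda>x. x ^ m)" for m
    by (rule integrable_const_bound[where B = "B ^ m"])
      (use bound in \<open>auto simp: power_abs intro!: power_mono elim!: eventually_mono\<close>)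
  have "norm (char M 1 - (\<Sum>m\<le>2. (\<i> * 1) ^ m / fact m * expectation (\<lambda>x. x ^ m))) \<le>
      \<bar>1\<bar>\<^sup>2 / fact (Suc 2) * expectation (\<lambda>x. min (2 * \<bar>x\<bar>\<^sup>2 * real (Suc 2)) (\<bar>1\<bar> * \<bar>x\<bar> ^ Suc 2))"
    using char_approx2[of 2 1, OF int] by simp
  also have "(\<Sum>m\<le>2. (\<i> * 1) ^ m / fact m * expectation (\<lambda>x. x ^ m)) =
      1 + \<i> * expectation (\<lambda>x. x) - expectation (\<lambda>x. x\<^sup>2) / 2"
    by (simp add: numeral_2_eq_2 prob_space[unfolded space_eq_univ] del: One_nat_def)
  also have "\<bar>1\<bar>\<^sup>2 / fact (Suc 2) * expectation (\<lambda>x. min (2 * \<bar>x\<bar>\<^sup>2 * real (Suc 2)) (\<bar>1\<bar> * \<bar>x\<bar> ^ Suc 2)) \<le>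
      \<bar>1\<bar>\<^sup>2 / fact (Suc 2) * expectation (\<lambda>x. B * x\<^sup>2)"
  proof (intro mult_left_mono integral_mono_AE)
    show "integrable M (\<lambda>x. min (2 * \<bar>x\<bar>\<^sup>2 * real (Suc 2)) (\<bar>1\<bar> * \<bar>x\<bar> ^ Suc 2))"
      by (rule Bochner_Integration.integrable_bound[where f = "\<lambda>x. 6 * x\<^sup>2"]) (use int in auto)
    have "min (2 * \<bar>x\<bar>\<^sup>2 * real (Suc 2)) (\<bar>1\<bar> * \<bar>x\<bar> ^ Suc 2) \<le> B * x\<^sup>2" if "\<bar>x\<bar> \<le> B" for x
      using mult_right_mono[OF that, of "x\<^sup>2"]
      by (intro min.coboundedI2) (simp only: power_Suc power2_abs abs_one mult_1 zero_le_power2)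
    then show "AE x in M. min (2 * \<bar>x\<bar>\<^sup>2 * real (Suc 2)) (\<bar>1\<bar> * \<bar>x\<bar> ^ Suc 2) \<le> B * x\<^sup>2"
      using bound by auto
  qed (use int in auto)
  finally show ?thesis
    by (simp add: fact_numeral)
qed

text \<open>The vanishing uniform bound \<open>B n\<close> takes the role of Lindeberg's condition:
  \<open>n\<close> times the Taylor remainder is at most \<open>B n\<close> times a convergent
  sequence. Raw second moments can stand for variances, since \<open>n\<close> times the squared
  mean tends to 0.\<close>

lemma (in prob_space) char_triangular_array_tendsto:
  fixes Y :: "nat \<Rightarrow> nat \<Rightarrow> 'a \<Rightarrow> real"
  assumes indep: "\<And>n. indep_vars (\<lambda>_. borel) (Y n) {1..n}"
    and law: "\<And>n i. i \<in> {1..n} \<Longrightarrow> distr M borel (Y n i) = \<mu> n"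
    and \<mu>: "\<And>n. real_distribution (\<mu> n)"
    and bound: "\<And>n. AE x in \<mu> n. \<bar>x\<bar> \<le> B n" and B: "B \<longlonglongrightarrow> 0"
    and mean: "(\<lambda>n. real n * (\<integral>x. x \<partial>\<mu> n)) \<longlonglongrightarrow> m"
    and square: "(\<lambda>n. real n * (\<integral>x. x\<^sup>2 \<partial>\<mu> n)) \<longlonglongrightarrow> v"
  shows "(\<lambda>n. char (distr M borel (\<lambda>\<omega>. \<Sum>i=1..n. Y n i \<omega>)) 1) \<longlonglongrightarrow> exp (\<i> * m - v / 2)"
proof -
  define \<phi> where "\<phi> n = char (\<mu> n) 1" for n
  have "char (distr M borel (\<lambda>\<omega>. \<Sum>i=1..n. Y n i \<omega>)) 1 = \<phi> n ^ n" for n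
    using char_distr_sum[OF indep, of n 1] law[of _ n] by (simp add: \<phi>_def)
  moreover have "(\<lambda>n. \<phi> n ^ n) \<longlonglongrightarrow> exp (\<i> * m - v / 2)"
  proof (rule tendsto_power_exp)
    show "\<forall>\<^sub>F n in sequentially. norm (\<phi> n) \<le> 1"
      unfolding \<phi>_def by (intro always_eventually allI real_distribution.cmod_char_le_1 \<mu>)
    have "0 \<le> v"
      by (rule tendsto_lowerbound[OF square]) auto
    then show "Re (\<i> * m - v / 2) \<le> 0"
      by simp
    let ?m = "\<lambda>n. \<integral>x. x \<partial>\<mu> n" and ?v = "\<lambda>n. \<integral>x. x\<^sup>2 \<partial>\<mu> n"
    have "(\<lambda>n. of_nat n * (\<phi> n - (1 + \<i> * ?m n - ?v n / 2))) \<longlonglongrightarrow> 0"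
    proof (rule Lim_null_comparison)
      have "(\<lambda>n. B n * (real n * ?v n) / 6) \<longlonglongrightarrow> 0 * v / 6"
        by (intro tendsto_intros B square) auto
      then show "(\<lambda>n. B n * (real n * ?v n) / 6) \<longlonglongrightarrow> 0"
        by simp
      have "norm (of_nat n * (\<phi> n - (1 + \<i> * ?m n - ?v n / 2))) \<le> B n * (real n * ?v n) / 6" for n
        using mult_left_mono[OF real_distribution.char_one_second_order[OF \<mu> bound], of "real n" n]
        by (simp add: \<phi>_def norm_mult mult_ac)
      then show "\<forall>\<^sub>F n in sequentially. norm (of_nat n * (\<phi> n - (1 + \<i> * ?m n - ?v n / 2))) \<le>
          B n * (real n * ?v n) / 6"
        by simp
    qed
    moreover have "(\<lambda>n. \<i> * of_real (real n * ?m n) - of_real (real n * ?v n / 2)) \<longlonglongrightarrow> \<i> * m - v / 2"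
      by (intro tendsto_diff tendsto_mult tendsto_const tendsto_of_real[OF mean]
          tendsto_of_real[OF tendsto_divide[OF square]]) simp
    ultimately have "(\<lambda>n. of_nat n * (\<phi> n - (1 + \<i> * ?m n - ?v n / 2)) +
        (\<i> * of_real (real n * ?m n) - of_real (real n * ?v n / 2))) \<longlonglongrightarrow> 0 + (\<i> * m - v / 2)"
      by (rule tendsto_add)
    moreover have "of_nat n * (\<phi> n - (1 + \<i> * ?m n - ?v n / 2)) +
        (\<i> * of_real (real n * ?m n) - of_real (real n * ?v n / 2)) = of_nat n * (\<phi> n - 1)" for n
      by (simp add: algebra_simps)
    ultimately show "(\<lambda>n. of_nat n * (\<phi> n - 1)) \<longlonglongrightarrow> \<i> * m - v / 2"
      by simp
  qed
  ultimately show ?thesis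
    by simp
qed

section \<open>Mean deviation of sums of independent variables\<close>

lemma (in prob_space) indep_centered_sum_square:
  fixes W :: "'i \<Rightarrow> 'a \<Rightarrow> real"
  assumes "finite I" and indep: "indep_vars (\<lambda>_. borel) W I"
    and int: "\<And>i. i \<in> I \<Longrightarrow> integrable M (\<lambda>\<omega>. (W i \<omega>)\<^sup>2)"
    and centered: "\<And>i. i \<in> I \<Longrightarrow> expectation (W i) = 0"
  shows "integrable M (\<lambda>\<omega>. (\<Sum>i\<in>I. W i \<omega>)\<^sup>2)"
    and "expectation (\<lambda>\<omega>. (\<Sum>i\<in>I. W i \<omega>)\<^sup>2) = (\<Sum>i\<in>I. expectation (\<lambda>\<omega>. (W i \<omega>)\<^sup>2))"
proof -
  have "integrable M (\<lambda>\<omega>. (\<Sum>i\<in>I. W i \<omega>)\<^sup>2) \<and>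
    expectation (\<lambda>\<omega>. (\<Sum>i\<in>I. W i \<omega>)\<^sup>2) = (\<Sum>i\<in>I. expectation (\<lambda>\<omega>. (W i \<omega>)\<^sup>2))"
    using assms
  proof (induction I)
    case (insert j F)
    let ?S = "\<lambda>\<omega>. \<Sum>i\<in>F. W i \<omega>"
    have rv: "random_variable borel (W i)" if "i \<in> insert j F" for i
      using insert.prems(1) that unfolding indep_vars_def2 by blast
    have sq: "integrable M (\<lambda>\<omega>. (W i \<omega>)\<^sup>2)" if "i \<in> insert j F" for i
      using insert.prems(2) that by blast
    have int_W: "integrable M (W i)" if "i \<in> insert j F" for i
      by (rule square_integrable_imp_integrable[OF rv[OF that] sq[OF that]])
    have IH: "integrable M (\<lambda>\<omega>. (?S \<omega>)\<^sup>2)"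
      "expectation (\<lambda>\<omega>. (?S \<omega>)\<^sup>2) = (\<Sum>i\<in>F. expectation (\<lambda>\<omega>. (W i \<omega>)\<^sup>2))"
      using insert.IH[OF indep_vars_subset[OF insert.prems(1)]] insert.prems by auto
    have int_S: "integrable M ?S"
      using int_W by auto
    have "indep_var borel (W j) borel ?S"
      using indep_vars_sum[OF insert.hyps insert.prems(1)] .
    from indep_var_lebesgue_integral[OF this] indep_var_integrable[OF this] int_W[of j] int_S
    have cross: "integrable M (\<lambda>\<omega>. W j \<omega> * ?S \<omega>)" "expectation (\<lambda>\<omega>. W j \<omega> * ?S \<omega>) = 0"
      using insert.prems(3) by auto
    have eq: "(\<Sum>i\<in>insert j F. W i \<omega>)\<^sup>2 = (W j \<omega>)\<^sup>2 + 2 * (W j \<omega> * ?S \<omega>) + (?S \<omega>)\<^sup>2" for \<omega>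
      using insert.hyps by (simp add: power2_sum)
    show ?case
      unfolding eq using insert.hyps cross IH sq by simp
  qed simp
  then show "integrable M (\<lambda>\<omega>. (\<Sum>i\<in>I. W i \<omega>)\<^sup>2)"
    "expectation (\<lambda>\<omega>. (\<Sum>i\<in>I. W i \<omega>)\<^sup>2) = (\<Sum>i\<in>I. expectation (\<lambda>\<omega>. (W i \<omega>)\<^sup>2))"
    by blast+
qed

text \<open>After centering, Jensen's inequality bounds the mean absolute value by the square root
  of the variance, and each variance by the raw second moment. The last summand is the bias. The
  purpose is the \<open>L1\<close> convergence of the denominator of the statistic.\<close>

lemma (in prob_space) indep_sum_mean_abs_deviation:
  fixes Y :: "'i \<Rightarrow> 'a \<Rightarrow> real"
  assumes I: "finite I" and indep: "indep_vars (\<lambda>_. borel) Y I"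
    and int: "\<And>i. i \<in> I \<Longrightarrow> integrable M (\<lambda>\<omega>. (Y i \<omega>)\<^sup>2)"
  shows "expectation (\<lambda>\<omega>. \<bar>(\<Sum>i\<in>I. Y i \<omega>) - a\<bar>) \<le>
    sqrt (\<Sum>i\<in>I. expectation (\<lambda>\<omega>. (Y i \<omega>)\<^sup>2)) + \<bar>(\<Sum>i\<in>I. expectation (Y i)) - a\<bar>"
proof -
  have rv: "random_variable borel (Y i)" if "i \<in> I" for i
    using indep that unfolding indep_vars_def2 by blast
  have int_Y: "integrable M (Y i)" if "i \<in> I" for i
    by (rule square_integrable_imp_integrable[OF rv[OF that] int[OF that]])
  define W where "W i \<omega> = Y i \<omega> - expectation (Y i)" for i \<omega>
  have W_sq: "(W i \<omega>)\<^sup>2 = (Y i \<omega>)\<^sup>2 - 2 * expectation (Y i) * Y i \<omega> + (expectation (Y i))\<^sup>2" for i \<omega>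
    by (simp add: W_def power2_diff algebra_simps)
  have int_W2: "integrable M (\<lambda>\<omega>. (W i \<omega>)\<^sup>2)" if "i \<in> I" for i
    unfolding W_sq using int[OF that] int_Y[OF that] by simp
  have W2_le: "expectation (\<lambda>\<omega>. (W i \<omega>)\<^sup>2) \<le> expectation (\<lambda>\<omega>. (Y i \<omega>)\<^sup>2)" if "i \<in> I" for i
    unfolding W_sq using int[OF that] int_Y[OF that] by (simp add: prob_space power2_eq_square)
  have indep_W: "indep_vars (\<lambda>_. borel) W I"
    unfolding W_def[abs_def] by (rule indep_vars_compose2[OF indep]) simp
  have mean_W: "expectation (W i) = 0" if "i \<in> I" for i
    unfolding W_def[abs_def] using int_Y[OF that] by (simp add: prob_space)
  note sq = indep_centered_sum_square[OF I indep_W int_W2 mean_W]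
  let ?S = "\<lambda>\<omega>. \<Sum>i\<in>I. W i \<omega>"
  have int_S: "integrable M ?S"
    using int_Y unfolding W_def by auto
  have "(expectation (\<lambda>\<omega>. \<bar>?S \<omega>\<bar>))\<^sup>2 \<le> expectation (\<lambda>\<omega>. \<bar>?S \<omega>\<bar>\<^sup>2)"
    using variance_positive[of "\<lambda>\<omega>. \<bar>?S \<omega>\<bar>"] variance_eq[of "\<lambda>\<omega>. \<bar>?S \<omega>\<bar>"] sq(1) int_S by simp
  also have "\<dots> \<le> (\<Sum>i\<in>I. expectation (\<lambda>\<omega>. (Y i \<omega>)\<^sup>2))"
    using sq(2) W2_le by (simp add: sum_mono)
  finally have L1: "expectation (\<lambda>\<omega>. \<bar>?S \<omega>\<bar>) \<le> sqrt (\<Sum>i\<in>I. expectation (\<lambda>\<omega>. (Y i \<omega>)\<^sup>2))"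
    by (rule real_le_rsqrt)
  have "\<bar>(\<Sum>i\<in>I. Y i \<omega>) - a\<bar> \<le> \<bar>?S \<omega>\<bar> + \<bar>(\<Sum>i\<in>I. expectation (Y i)) - a\<bar>" for \<omega>
    by (simp add: W_def sum_subtractf)
  then have "expectation (\<lambda>\<omega>. \<bar>(\<Sum>i\<in>I. Y i \<omega>) - a\<bar>) \<le>
      expectation (\<lambda>\<omega>. \<bar>?S \<omega>\<bar> + \<bar>(\<Sum>i\<in>I. expectation (Y i)) - a\<bar>)"
    using int_Y int_S by (intro integral_mono) auto
  also have "\<dots> = expectation (\<lambda>\<omega>. \<bar>?S \<omega>\<bar>) + \<bar>(\<Sum>i\<in>I. expectation (Y i)) - a\<bar>"
    using int_S by (simp add: prob_space)
  finally show ?thesis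
    using L1 by linarith
qed

section \<open>Gaussian linearization of quadratic forms\<close>

lemma (in prob_space) std_normal_vector_char:
  fixes \<xi> :: "'i \<Rightarrow> 'a \<Rightarrow> real"
  assumes indep: "indep_vars (\<lambda>_. borel) \<xi> I"
    and normal: "\<And>i. i \<in> I \<Longrightarrow> distributed M lborel (\<xi> i) std_normal_density"
  shows "(CLINT \<omega>|M. iexp (\<Sum>i\<in>I. a i * \<xi> i \<omega>)) = of_real (exp (- (\<Sum>i\<in>I. (a i)\<^sup>2) / 2))"
proof -
  have rv: "random_variable borel (\<xi> i)" if "i \<in> I" for i
    using indep that unfolding indep_vars_def2 by blast
  have indep': "indep_vars (\<lambda>_. borel) (\<lambda>i \<omega>. a i * \<xi> i \<omega>) I"
    by (rule indep_vars_compose2[OF indep]) simp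
  have char: "char (distr M borel (\<lambda>\<omega>. a i * \<xi> i \<omega>)) 1 = of_real (exp (- (a i)\<^sup>2 / 2))" if "i \<in> I" for i
  proof -
    have "distr M borel (\<xi> i) = std_normal_distribution"
      using distributed_distr_eq_density[OF normal[OF that]]
      by (metis distr_cong sets_lborel)
    then have "char (distr M borel (\<xi> i)) (a i) = of_real (exp (- (a i)\<^sup>2 / 2))"
      by (simp add: char_std_normal_distribution)
    moreover have "char (distr M borel (\<lambda>\<omega>. a i * \<xi> i \<omega>)) 1 = char (distr M borel (\<xi> i)) (a i)"
      using rv[OF that] by (simp add: char_def integral_distr)
    ultimately show ?thesis
      by simp
  qed
  have "(CLINT \<omega>|M. iexp (\<Sum>i\<in>I. a i * \<xi> i \<omega>)) = char (distr M borel (\<lambda>\<omega>. \<Sum>i\<in>I. a i * \<xi> i \<omega>)) 1"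
    using rv by (simp add: char_def integral_distr)
  also have "\<dots> = (\<Prod>i\<in>I. of_real (exp (- (a i)\<^sup>2 / 2)))"
    unfolding char_distr_sum[OF indep'] using char by simp
  also have "\<dots> = of_real (exp (- (\<Sum>i\<in>I. (a i)\<^sup>2) / 2))"
    \<comment> \<open>For infinite \<open>I\<close> the sum defaults to 0 and the product to 1, so
      both sides are 1.\<close>
    by (cases "finite I") (simp_all add: exp_sum sum_divide_distrib flip: of_real_prod sum_negf)
  finally show ?thesis .
qed

text \<open>The idea is to write \<open>exp (- s y\<^sup>2)\<close> as the characteristic function of a normal variable at
  \<open>sqrt (2 s) y\<close>.\<close>

lemma laplace_quadratic_form_tendsto:
  fixes F :: "nat \<Rightarrow> 'i \<Rightarrow> 'b \<Rightarrow> real" and \<xi> :: "'i \<Rightarrow> 'q \<Rightarrow> real" and \<rho> :: "'i \<Rightarrow> real"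
  assumes N: "prob_space N" and Q: "prob_space Q"
    and F: "\<And>n i. i \<in> I \<Longrightarrow> F n i \<in> borel_measurable N"
    and indep: "prob_space.indep_vars Q (\<lambda>_. borel) \<xi> I"
    and normal: "\<And>i. i \<in> I \<Longrightarrow> distributed Q lborel (\<xi> i) std_normal_density"
    and char_F: "\<And>a. (\<lambda>n. CLINT \<omega>|N. iexp (\<Sum>i\<in>I. a i * F n i \<omega>)) \<longlonglongrightarrow>
      of_real (exp (- (\<Sum>i\<in>I. \<rho> i * (a i)\<^sup>2) / 2))"
    and s: "0 \<le> s"
  shows "(\<lambda>n. \<integral>\<omega>. exp (- (s * (\<Sum>i\<in>I. (F n i \<omega>)\<^sup>2))) \<partial>N) \<longlonglongrightarrow>
    (\<integral>q. exp (- (s * (\<Sum>i\<in>I. \<rho> i * (\<xi> i q)\<^sup>2))) \<partial>Q)"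
proof -
  interpret N: prob_space N by fact
  interpret Q: prob_space Q by fact
  interpret NQ: pair_prob_space N Q ..
  let ?r = "sqrt (2 * s)"
  have \<xi>: "\<xi> i \<in> borel_measurable Q" if "i \<in> I" for i
    using indep that unfolding Q.indep_vars_def2 by blast
  have "complex_of_real (\<integral>\<omega>. exp (- (s * (\<Sum>i\<in>I. (F n i \<omega>)\<^sup>2))) \<partial>N) =
      (CLINT q|Q. CLINT \<omega>|N. iexp (\<Sum>i\<in>I. ?r * \<xi> i q * F n i \<omega>))" for n
  proof -
    have "complex_of_real (exp (- (s * (\<Sum>i\<in>I. (F n i \<omega>)\<^sup>2)))) =
        (CLINT q|Q. iexp (\<Sum>i\<in>I. ?r * \<xi> i q * F n i \<omega>))" for \<omega>
    proof -
      have "(CLINT q|Q. iexp (\<Sum>i\<in>I. ?r * \<xi> i q * F n i \<omega>)) =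
          (CLINT q|Q. iexp (\<Sum>i\<in>I. (?r * F n i \<omega>) * \<xi> i q))"
        by (simp add: mult_ac)
      also have "\<dots> = of_real (exp (- (\<Sum>i\<in>I. (?r * F n i \<omega>)\<^sup>2) / 2))"
        by (rule Q.std_normal_vector_char[OF indep normal])
      also have "(\<Sum>i\<in>I. (?r * F n i \<omega>)\<^sup>2) = 2 * s * (\<Sum>i\<in>I. (F n i \<omega>)\<^sup>2)"
        using s by (simp add: power_mult_distrib sum_distrib_left)
      finally show ?thesis
        by simp
    qed
    then have "complex_of_real (\<integral>\<omega>. exp (- (s * (\<Sum>i\<in>I. (F n i \<omega>)\<^sup>2))) \<partial>N) =
        (CLINT \<omega>|N. CLINT q|Q. iexp (\<Sum>i\<in>I. ?r * \<xi> i q * F n i \<omega>))"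
      by (simp flip: integral_complex_of_real)
    also have "\<dots> = (CLINT q|Q. CLINT \<omega>|N. iexp (\<Sum>i\<in>I. ?r * \<xi> i q * F n i \<omega>))"
    proof (rule NQ.Fubini_integral[symmetric])
      have "(\<lambda>(\<omega>, q). \<Sum>i\<in>I. ?r * \<xi> i q * F n i \<omega>) \<in> borel_measurable (N \<Otimes>\<^sub>M Q)"
        unfolding split_beta'
        by (intro borel_measurable_sum borel_measurable_times borel_measurable_const
            measurable_compose[OF measurable_fst F] measurable_compose[OF measurable_snd \<xi>])
      then show "integrable (N \<Otimes>\<^sub>M Q) (\<lambda>(\<omega>, q). iexp (\<Sum>i\<in>I. ?r * \<xi> i q * F n i \<omega>))"
        unfolding split_beta' by (rule NQ.P.integrable_iexp[OF measurable_compose[OF _ borel_measurable_of_real]]) simp_all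
    qed
    finally show ?thesis .
  qed
  \<comment> \<open>For fixed \<open>q\<close> the inner integral is that of \<open>char_F\<close>
    with the coefficients \<open>?r * \<xi> i q\<close>. It is bounded by 1, so dominated
    convergence applies; squaring \<open>?r\<close> gives \<open>2 * s\<close>, which cancels the 2
    in the Gaussian exponent.\<close>
  moreover have "(\<lambda>n. CLINT q|Q. CLINT \<omega>|N. iexp (\<Sum>i\<in>I. ?r * \<xi> i q * F n i \<omega>)) \<longlonglongrightarrow>
      (CLINT q|Q. of_real (exp (- (s * (\<Sum>i\<in>I. \<rho> i * (\<xi> i q)\<^sup>2)))))"
  proof (rule integral_dominated_convergence[where w = "\<lambda>_. 1"])
    have sum_eq: "(\<Sum>i\<in>I. \<rho> i * (?r * \<xi> i q)\<^sup>2) = 2 * (s * (\<Sum>i\<in>I. \<rho> i * (\<xi> i q)\<^sup>2))" for q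
      using s by (simp add: power_mult_distrib sum_distrib_left mult_ac)
    have "(\<lambda>n. CLINT \<omega>|N. iexp (\<Sum>i\<in>I. ?r * \<xi> i q * F n i \<omega>)) \<longlonglongrightarrow>
        of_real (exp (- (s * (\<Sum>i\<in>I. \<rho> i * (\<xi> i q)\<^sup>2))))" for q
      using char_F[of "\<lambda>i. ?r * \<xi> i q"] unfolding sum_eq by simp
    then show "AE q in Q. (\<lambda>n. CLINT \<omega>|N. iexp (\<Sum>i\<in>I. ?r * \<xi> i q * F n i \<omega>)) \<longlonglongrightarrow>
        of_real (exp (- (s * (\<Sum>i\<in>I. \<rho> i * (\<xi> i q)\<^sup>2))))"
      by simp
    show "AE q in Q. norm (CLINT \<omega>|N. iexp (\<Sum>i\<in>I. ?r * \<xi> i q * F n i \<omega>)) \<le> 1" for n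
    proof (intro AE_I2)
      fix q
      have "norm (CLINT \<omega>|N. iexp (\<Sum>i\<in>I. ?r * \<xi> i q * F n i \<omega>)) \<le>
          (\<integral>\<omega>. norm (iexp (\<Sum>i\<in>I. ?r * \<xi> i q * F n i \<omega>)) \<partial>N)"
        by (rule integral_norm_bound)
      then show "norm (CLINT \<omega>|N. iexp (\<Sum>i\<in>I. ?r * \<xi> i q * F n i \<omega>)) \<le> 1"
        by (simp add: N.prob_space)
    qed
    show "(\<lambda>q. CLINT \<omega>|N. iexp (\<Sum>i\<in>I. ?r * \<xi> i q * F n i \<omega>)) \<in> borel_measurable Q" for n
    proof (rule N.borel_measurable_lebesgue_integral)
      have "(\<lambda>(q, \<omega>). \<Sum>i\<in>I. ?r * \<xi> i q * F n i \<omega>) \<in> borel_measurable (Q \<Otimes>\<^sub>M N)"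
        unfolding split_beta'
        by (intro borel_measurable_sum borel_measurable_times borel_measurable_const
            measurable_compose[OF measurable_fst \<xi>] measurable_compose[OF measurable_snd F])
      then show "(\<lambda>(q, \<omega>). iexp (\<Sum>i\<in>I. ?r * \<xi> i q * F n i \<omega>)) \<in> borel_measurable (Q \<Otimes>\<^sub>M N)"
        unfolding split_beta' by measurable
    qed
    show "(\<lambda>q. complex_of_real (exp (- (s * (\<Sum>i\<in>I. \<rho> i * (\<xi> i q)\<^sup>2))))) \<in> borel_measurable Q"
      by (intro measurable_compose[OF _ borel_measurable_of_real] measurable_compose[OF _ borel_measurable_exp] borel_measurable_uminus
          borel_measurable_times borel_measurable_const borel_measurable_sum borel_measurable_power \<xi>)
  qed simp
  ultimately have "(\<lambda>n. complex_of_real (\<integral>\<omega>. exp (- (s * (\<Sum>i\<in>I. (F n i \<omega>)\<^sup>2))) \<partial>N)) \<longlonglongrightarrow>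
      complex_of_real (\<integral>q. exp (- (s * (\<Sum>i\<in>I. \<rho> i * (\<xi> i q)\<^sup>2))) \<partial>Q)"
    by simp
  then show ?thesis
    by (simp only: tendsto_of_real_iff)
qed

text \<open>Slutsky's argument on the level of Laplace transforms: dividing by \<open>A n\<close>
  changes the transform by at most twice the \<open>L1\<close> distance of \<open>A n\<close> from
  1, whatever the size of the numerator. Points where \<open>A n\<close> vanishes are covered by the
  same bound.\<close>

lemma weak_conv_normalized_quadratic_form:
  fixes F :: "nat \<Rightarrow> 'i \<Rightarrow> 'b \<Rightarrow> real" and \<xi> :: "'i \<Rightarrow> 'q \<Rightarrow> real" and \<rho> :: "'i \<Rightarrow> real"
    and A :: "nat \<Rightarrow> 'b \<Rightarrow> real"
  assumes N: "prob_space N" and Q: "prob_space Q"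
    and F: "\<And>n i. i \<in> I \<Longrightarrow> F n i \<in> borel_measurable N"
    and indep: "prob_space.indep_vars Q (\<lambda>_. borel) \<xi> I"
    and normal: "\<And>i. i \<in> I \<Longrightarrow> distributed Q lborel (\<xi> i) std_normal_density"
    and char_F: "\<And>a. (\<lambda>n. CLINT \<omega>|N. iexp (\<Sum>i\<in>I. a i * F n i \<omega>)) \<longlonglongrightarrow>
      of_real (exp (- (\<Sum>i\<in>I. \<rho> i * (a i)\<^sup>2) / 2))"
    and \<rho>: "\<And>i. i \<in> I \<Longrightarrow> 0 \<le> \<rho> i"
    and A: "\<And>n. integrable N (A n)" "\<And>n \<omega>. 0 \<le> A n \<omega>"
      "(\<lambda>n. \<integral>\<omega>. \<bar>A n \<omega> - 1\<bar> \<partial>N) \<longlonglongrightarrow> 0"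
  shows "weak_conv_m (\<lambda>n. distr N borel (\<lambda>\<omega>. (\<Sum>i\<in>I. (F n i \<omega>)\<^sup>2) / A n \<omega>))
    (distr Q borel (\<lambda>q. \<Sum>i\<in>I. \<rho> i * (\<xi> i q)\<^sup>2))"
proof (rule laplace_convergence_imp_weak_conv)
  interpret N: prob_space N by fact
  interpret Q: prob_space Q by fact
  have \<xi>: "\<xi> i \<in> borel_measurable Q" if "i \<in> I" for i
    using indep that unfolding Q.indep_vars_def2 by blast
  let ?V = "\<lambda>n \<omega>. \<Sum>i\<in>I. (F n i \<omega>)\<^sup>2" and ?W = "\<lambda>q. \<Sum>i\<in>I. \<rho> i * (\<xi> i q)\<^sup>2"
  have V: "?V n \<in> borel_measurable N" for n
    using F by auto
  have T: "(\<lambda>\<omega>. ?V n \<omega> / A n \<omega>) \<in> borel_measurable N" for n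
    using V A(1) by (intro borel_measurable_divide) auto
  have W: "?W \<in> borel_measurable Q"
    using \<xi> by auto
  have V0: "0 \<le> ?V n \<omega>" for n \<omega>
    by (simp add: sum_nonneg)
  have T0: "0 \<le> ?V n \<omega> / A n \<omega>" for n \<omega>
    by (intro divide_nonneg_nonneg V0 A)
  have W0: "0 \<le> ?W q" for q
    using \<rho> by (simp add: sum_nonneg)
  show "real_distribution (distr N borel (\<lambda>\<omega>. ?V n \<omega> / A n \<omega>))" for n
    by (rule N.real_distribution_distr) (rule T)
  show "real_distribution (distr Q borel ?W)"
    by (rule Q.real_distribution_distr) (rule W)
  show "AE x in distr N borel (\<lambda>\<omega>. ?V n \<omega> / A n \<omega>). 0 \<le> x" for n
    using T T0 by (simp add: AE_distr_iff)
  show "AE x in distr Q borel ?W. 0 \<le> x"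
    using W W0 by (simp add: AE_distr_iff)
  fix s :: nat
  have int: "integrable N (\<lambda>\<omega>. exp (- (real s * f \<omega>)))"
    if "f \<in> borel_measurable N" "\<And>\<omega>. 0 \<le> f \<omega>" for f
    using that by (intro N.integrable_const_bound[where B = 1]) auto
  have "(\<lambda>n. (\<integral>\<omega>. exp (- (real s * (?V n \<omega> / A n \<omega>))) \<partial>N) - (\<integral>\<omega>. exp (- (real s * ?V n \<omega>)) \<partial>N)) \<longlonglongrightarrow> 0"
  proof (rule Lim_null_comparison)
    show "(\<lambda>n. 2 * (\<integral>\<omega>. \<bar>A n \<omega> - 1\<bar> \<partial>N)) \<longlonglongrightarrow> 0"
      using tendsto_mult_right_zero[OF A(3)] .
    have "norm ((\<integral>\<omega>. exp (- (real s * (?V n \<omega> / A n \<omega>))) \<partial>N) - (\<integral>\<omega>. exp (- (real s * ?V n \<omega>)) \<partial>N)) \<le>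
        2 * (\<integral>\<omega>. \<bar>A n \<omega> - 1\<bar> \<partial>N)" for n
    proof -
      let ?g = "\<lambda>\<omega>. exp (- (real s * (?V n \<omega> / A n \<omega>))) - exp (- (real s * ?V n \<omega>))"
      have int_g: "integrable N ?g"
        by (intro Bochner_Integration.integrable_diff int T V T0 V0)
      have "norm ((\<integral>\<omega>. exp (- (real s * (?V n \<omega> / A n \<omega>))) \<partial>N) - (\<integral>\<omega>. exp (- (real s * ?V n \<omega>)) \<partial>N)) =
          \<bar>\<integral>\<omega>. ?g \<omega> \<partial>N\<bar>"
        by (simp only: real_norm_def Bochner_Integration.integral_diff[OF int[OF T T0] int[OF V V0]])
      also have "\<dots> \<le> (\<integral>\<omega>. \<bar>?g \<omega>\<bar> \<partial>N)"
        by (rule integral_abs_bound)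
      also have "\<dots> \<le> (\<integral>\<omega>. 2 * \<bar>A n \<omega> - 1\<bar> \<partial>N)"
      proof (rule integral_mono)
        show "\<bar>?g \<omega>\<bar> \<le> 2 * \<bar>A n \<omega> - 1\<bar>" for \<omega>
          using abs_exp_divide_diff_le[of "real s * ?V n \<omega>" "A n \<omega>"] V0[of n \<omega>] A(2)[of n \<omega>] by simp
      qed (use int_g A(1) in auto)
      finally show ?thesis
        by simp
    qed
    then show "\<forall>\<^sub>F n in sequentially. norm ((\<integral>\<omega>. exp (- (real s * (?V n \<omega> / A n \<omega>))) \<partial>N) -
        (\<integral>\<omega>. exp (- (real s * ?V n \<omega>)) \<partial>N)) \<le> 2 * (\<integral>\<omega>. \<bar>A n \<omega> - 1\<bar> \<partial>N)"
      by simp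
  qed
  from tendsto_add[OF this laplace_quadratic_form_tendsto[OF N Q F indep normal char_F, of "real s"]]
  have "(\<lambda>n. \<integral>\<omega>. exp (- (real s * (?V n \<omega> / A n \<omega>))) \<partial>N) \<longlonglongrightarrow> (\<integral>q. exp (- (real s * ?W q)) \<partial>Q)"
    by simp
  then show "(\<lambda>n. \<integral>x. exp (- (real s * x)) \<partial>distr N borel (\<lambda>\<omega>. ?V n \<omega> / A n \<omega>)) \<longlonglongrightarrow>
      (\<integral>x. exp (- (real s * x)) \<partial>distr Q borel ?W)"
    using T W by (simp add: integral_distr)
qed

section \<open>Exceedances over the grid\<close>

text \<open>The statistic sees each path only through finitely many coordinates. Independence and
  equality of laws on the product sigma-algebra therefore pass to every functional of the paths that
  is used.\<close>

lemma independent_copies_functional: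
  assumes X: "independent_copies N X M U" and H: "H \<in> borel_measurable path_space"
    and U: "\<And>t. t \<in> {0..1} \<Longrightarrow> U t \<in> borel_measurable M"
  shows "prob_space.indep_vars N (\<lambda>_. borel) (\<lambda>i \<omega>. H (process_path (X i) \<omega>)) {1..n}"
    and "1 \<le> i \<Longrightarrow> distr N borel (\<lambda>\<omega>. H (process_path (X i) \<omega>)) = distr M borel (\<lambda>\<omega>. H (process_path U \<omega>))"
proof -
  interpret N: prob_space N
    using X by (simp add: independent_copies_def)
  have indep: "N.indep_vars (\<lambda>_. path_space) (\<lambda>i. process_path (X i)) {1..}"
    and law: "\<And>i. 1 \<le> i \<Longrightarrow> distr N path_space (process_path (X i)) = distr M path_space (process_path U)"
    using X by (simp_all add: independent_copies_def)
  have meas_X: "process_path (X i) \<in> measurable N path_space" if "1 \<le> i" for i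
    using indep that unfolding N.indep_vars_def2 by auto
  have meas_U: "process_path U \<in> measurable M path_space"
    unfolding process_path_def[abs_def] by (rule measurable_restrict) (rule U)
  show "N.indep_vars (\<lambda>_. borel) (\<lambda>i \<omega>. H (process_path (X i) \<omega>)) {1..n}"
    by (rule N.indep_vars_compose2[OF N.indep_vars_subset[OF indep]]) (use H in auto)
  assume i: "1 \<le> i"
  have "distr N borel (\<lambda>\<omega>. H (process_path (X i) \<omega>)) = distr (distr N path_space (process_path (X i))) borel H"
    using distr_distr[OF H meas_X[OF i]] by (simp add: comp_def)
  also have "\<dots> = distr M borel (\<lambda>\<omega>. H (process_path U \<omega>))"
    unfolding law[OF i] using distr_distr[OF H meas_U] by (simp add: comp_def)
  finally show "distr N borel (\<lambda>\<omega>. H (process_path (X i) \<omega>)) = distr M borel (\<lambda>\<omega>. H (process_path U \<omega>))" .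
qed

text \<open>With \<open>u = c / j\<close> this is the contribution of one path to the count
  \<open>n\<^sub>j(c)\<close>.\<close>

definition exceed :: "(nat \<Rightarrow> real) \<Rightarrow> nat \<Rightarrow> real \<Rightarrow> (real \<Rightarrow> real) \<Rightarrow> real" where
  "exceed s d u x = of_bool (\<exists>r\<in>{1..d}. 1 - u < x (s r))"

text \<open>Summed over the sample, this gives the linear form with weights \<open>w j\<close> in
  the numbers \<open>j * n\<^sub>j(c)\<close>. Such forms thereby become sums of independent,
  identically distributed terms.\<close>

definition weighted_exceed ::
  "(nat \<Rightarrow> real) \<Rightarrow> nat \<Rightarrow> (nat \<Rightarrow> real) \<Rightarrow> nat \<Rightarrow> real \<Rightarrow> (real \<Rightarrow> real) \<Rightarrow> real" where
  "weighted_exceed w k s d c x = (\<Sum>j=1..k. w j * real j * exceed s d (c / real j) x)"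

lemma exceedances_eq: "exceedances x n s d c j = (\<Sum>i=1..n. exceed s d (c / real j) (x i))"
  unfolding exceedances_def
proof (rule sum.cong[OF refl])
  fix i
  let ?h = "\<lambda>r. indicator {- (c / real j)<..} (x i (s r) - 1) :: real"
  have of_bool: "indicator {0<..} S = (of_bool (0 < S) :: real)" for S :: real
    by (simp add: indicator_def)
  have h: "0 < ?h r \<longleftrightarrow> 1 - c / real j < x i (s r)" for r
    by (auto simp: indicator_def)
  have pos: "0 < (\<Sum>r=1..d. ?h r) \<longleftrightarrow> (\<exists>r\<in>{1..d}. 0 < ?h r)"
  proof
    assume "0 < (\<Sum>r=1..d. ?h r)"
    then show "\<exists>r\<in>{1..d}. 0 < ?h r"
      using sum_nonpos[of "{1..d}" ?h] by (meson leD linorder_not_le)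
  qed (metis (no_types, lifting) finite_atLeastAtMost indicator_pos_le sum_pos2)
  show "indicator {0::real<..} (\<Sum>r=1..d. ?h r) = exceed s d (c / real j) (x i)"
    by (simp only: of_bool pos h exceed_def)
qed

section \<open>Measurability and nesting of the exceedance indicators\<close>

lemma exceed_measurable:
  assumes "\<And>r. r \<in> {1..d} \<Longrightarrow> s r \<in> {0..1}"
  shows "exceed s d u \<in> borel_measurable path_space"
proof -
  have "{x \<in> space path_space. \<exists>r\<in>{1..d}. 1 - u < x (s r)} \<in> sets path_space"
  proof (rule sets.sets_Collect_finite_Ex)
    fix r
    assume "r \<in> {1..d}"
    then have "(\<lambda>x. x (s r)) \<in> borel_measurable path_space"
      by (intro measurable_component_singleton assms)
    then show "{x \<in> space path_space. 1 - u < x (s r)} \<in> sets path_space"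
      by (intro borel_measurable_less) auto
  qed simp
  then show ?thesis
    unfolding exceed_def[abs_def] of_bool_def by (intro measurable_If) auto
qed

lemma exceed_process_path:
  "(\<And>r. r \<in> {1..d} \<Longrightarrow> s r \<in> {0..1}) \<Longrightarrow> exceed s d u (process_path X \<omega>) = exceed s d u (\<lambda>t. X t \<omega>)"
  by (auto simp: exceed_def process_path_def)

text \<open>The events are nested: a larger \<open>u\<close> means a lower threshold, so the rarer
  event, with the smaller \<open>u\<close>, implies the other.\<close>

lemma exceed_mult: "exceed s d u x * exceed s d v x = exceed s d (min u v) x"
proof -
  have "exceed s d v x = 1" if "exceed s d u x = 1" "u \<le> v" for u v
    using that by (force simp: exceed_def)
  moreover have "exceed s d u x = 0 \<or> exceed s d u x = 1" for u
    by (auto simp add: exceed_def)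
  ultimately show ?thesis
    by (smt (verit) min_def mult_cancel_left1 mult_cancel_right1 mult_eq_0_iff)
qed

lemma weighted_exceed_measurable:
  "(\<And>r. r \<in> {1..d} \<Longrightarrow> s r \<in> {0..1}) \<Longrightarrow> weighted_exceed w k s d c \<in> borel_measurable path_space"
  unfolding weighted_exceed_def[abs_def]
  by (intro borel_measurable_sum borel_measurable_times borel_measurable_const exceed_measurable) auto

lemma weighted_exceed_process_path:
  "(\<And>r. r \<in> {1..d} \<Longrightarrow> s r \<in> {0..1}) \<Longrightarrow>
    weighted_exceed w k s d c (process_path X \<omega>) = weighted_exceed w k s d c (\<lambda>t. X t \<omega>)"
  unfolding weighted_exceed_def by (rule sum.cong[OF refl], subst exceed_process_path) auto

lemma abs_weighted_exceed_le: "\<bar>weighted_exceed w k s d c x\<bar> \<le> (\<Sum>j=1..k. \<bar>w j\<bar> * real j)"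
  unfolding weighted_exceed_def
  by (rule order_trans[OF sum_abs], rule sum_mono) (simp add: abs_mult exceed_def)

lemma sum_weighted_exceed:
  "(\<Sum>i=1..n. weighted_exceed w k s d c (x i)) = (\<Sum>j=1..k. w j * (real j * exceedances x n s d c j))"
  unfolding weighted_exceed_def exceedances_eq sum_distrib_left by (subst sum.swap) (simp only: mult.assoc)

text \<open>By nesting, the product of two indicators is the one for \<open>max j l\<close>, and
  \<open>j * l\<close> splits into \<open>min j l\<close> times \<open>max j l\<close>. The mean of
  \<open>max j l\<close> times that indicator is to first order the same for all pairs, so
  \<open>min j l\<close> emerges as the covariance.\<close>

lemma weighted_exceed_square:
  assumes "0 \<le> c"
  shows "(weighted_exceed w k s d c x)\<^sup>2 =
    (\<Sum>j=1..k. \<Sum>l=1..k. w j * w l * real (min j l) * (real (max j l) * exceed s d (c / real (max j l)) x))"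
proof -
  have *: "c / real l \<le> c / real j" if "1 \<le> j" "j \<le> l" for j l
    using that assms by (intro divide_left_mono) auto
  have **: "w j * real j * exceed s d (c / real j) x * (w l * real l * exceed s d (c / real l) x) =
      w j * w l * real (min j l) * (real (max j l) * exceed s d (c / real (max j l)) x)"
    if "j \<in> {1..k}" "l \<in> {1..k}" for j l
  proof -
    have "min (c / real j) (c / real l) = c / real (max j l)"
    proof (cases "j \<le> l")
      case True
      then show ?thesis
        using *[of j l] that by (simp add: min_absorb2 max_absorb2)
    next
      case False
      then show ?thesis
        using *[of l j] that by (simp add: min_absorb1 max_absorb1)
    qed
    moreover have "real j * real l = real (min j l) * real (max j l)"
      by (simp add: min_def max_def)
    moreover have "w j * real j * exceed s d (c / real j) x * (w l * real l * exceed s d (c / real l) x) =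
        w j * w l * (real j * real l) * (exceed s d (c / real j) x * exceed s d (c / real l) x)"
      by simp
    ultimately show ?thesis
      by (simp only: exceed_mult mult.assoc)
  qed
  show ?thesis
    unfolding weighted_exceed_def power2_eq_square sum_product
    by (rule sum.cong[OF refl], rule sum.cong[OF refl], rule **)
qed

section \<open>Exceedance probabilities from the expansion of the D-norm\<close>

lemma continuous_le_on_unit_interval:
  fixes f :: "real \<Rightarrow> real"
  assumes f: "continuous_on {0..1} f" and le: "\<And>t. t \<in> {0<..<1} \<inter> \<rat> \<Longrightarrow> f t \<le> a" and t: "t \<in> {0..1}"
  shows "f t \<le> a"
proof -
  have "{0<..<1} \<subseteq> closure ({0<..<1} \<inter> \<rat> :: real set)"
    using open_Int_closure_subset[of "{0<..<1::real}" \<rat>] by (simp add: Rats_closure_real)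
  then have "closure {0<..<1::real} \<subseteq> closure ({0<..<1} \<inter> \<rat>)"
    by (rule closure_minimal) simp
  then have sub: "{0..1} \<subseteq> closure ({0<..<1} \<inter> \<rat> :: real set)"
    by simp
  moreover have "closure ({0<..<1} \<inter> \<rat> :: real set) \<subseteq> {0..1}"
    by (rule closure_minimal) auto
  ultimately show ?thesis
    using continuous_le_on_closure[of "{0<..<1} \<inter> \<rat>" f t a] f le t by (metis subset_antisym)
qed

text \<open>A test function that vanishes off the grid still imposes the bound 1 at all other times.
  The uniform margins give this bound almost surely at each single time; continuity of the paths
  extends it from the countably many rational times to all times at once and makes the event
  measurable.\<close>

lemma copula_paths_le_1:
  assumes U: "copula_process M U" "continuous_paths M U"
  shows "{\<omega> \<in> space M. \<forall>t\<in>{0..1}. U t \<omega> \<le> 1} \<in> sets M"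
    and "AE \<omega> in M. \<forall>t\<in>{0..1}. U t \<omega> \<le> 1"
proof -
  have rv: "U t \<in> borel_measurable M" if "t \<in> {0..1}" for t
    using U(1) that by (simp add: copula_process_def)
  have path: "(\<forall>t\<in>{0..1}. U t \<omega> \<le> 1) \<longleftrightarrow> (\<forall>t\<in>{0<..<1} \<inter> \<rat>. U t \<omega> \<le> 1)" if "\<omega> \<in> space M" for \<omega>
    using continuous_le_on_unit_interval[of "\<lambda>t. U t \<omega>" 1] U(2) that by (auto simp: continuous_paths_def)
  have count: "countable ({0<..<1} \<inter> \<rat> :: real set)"
    by (intro countable_Int2 countable_rat)
  have "{\<omega> \<in> space M. \<forall>t\<in>{0..1}. U t \<omega> \<le> 1} = {\<omega> \<in> space M. \<forall>t\<in>{0<..<1} \<inter> \<rat>. U t \<omega> \<le> 1}"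
    using path by blast
  also have "\<dots> \<in> sets M"
    by (rule sets.sets_Collect_countable_All'[OF _ count]) (use rv in auto)
  finally show "{\<omega> \<in> space M. \<forall>t\<in>{0..1}. U t \<omega> \<le> 1} \<in> sets M" .
  have "AE \<omega> in M. U t \<omega> \<le> 1" if t: "t \<in> {0..1}" for t
  proof (rule AE_distrD[OF rv[OF t]])
    show "AE x in distr M borel (U t). x \<le> 1"
    proof -
      have "distr M borel (U t) = uniform_measure lborel {0<..<1}"
        using U(1) t by (simp add: copula_process_def)
      then show ?thesis
        by (simp only:) (rule AE_uniform_measureI, auto)
    qed
  qed
  then have "AE \<omega> in M. \<forall>t\<in>{0<..<1} \<inter> \<rat>. U t \<omega> \<le> 1"
    by (intro AE_ball_countable[OF count, THEN iffD2]) auto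
  then show "AE \<omega> in M. \<forall>t\<in>{0..1}. U t \<omega> \<le> 1"
    using path by (auto elim!: AE_mp)
qed

text \<open>The test function that turns the functional expansion into one for the grid. It has
  finitely many jumps, hence lies in \<open>E01\<close>, and up to a null set the bound
  \<open>1 + c * f\<close> for this \<open>f\<close> says that no grid value exceeds
  \<open>1 - c * b\<close>.\<close>

definition grid_spike :: "(nat \<Rightarrow> real) \<Rightarrow> nat \<Rightarrow> real \<Rightarrow> real \<Rightarrow> real" where
  "grid_spike s d b t = (if t \<in> s ` {1..d} then - b else 0)"

text \<open>The D-norm of the vector of ones in dimension \<open>d\<close>, generated by the
  projection of \<open>Z\<close> onto the grid.\<close>

definition grid_max_mean :: "'g measure \<Rightarrow> (real \<Rightarrow> 'g \<Rightarrow> real) \<Rightarrow> (nat \<Rightarrow> real) \<Rightarrow> nat \<Rightarrow> real" where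
  "grid_max_mean G Z s d = (\<integral>\<omega>. Max ((\<lambda>r. Z (s r) \<omega>) ` {1..d}) \<partial>G)"

lemma grid_spike_E01_nonpos:
  assumes "0 \<le> b"
  shows "grid_spike s d b \<in> E01_nonpos"
proof -
  have "grid_spike s d b ` {0..1} \<subseteq> {- b, 0}"
    by (auto simp: grid_spike_def)
  then have "bounded (grid_spike s d b ` {0..1})"
    by (rule bounded_subset[rotated]) (simp add: finite_imp_bounded)
  moreover have "continuous (at t within {0..1}) (grid_spike s d b)" if "t \<notin> s ` {1..d}" for t
  proof (rule continuous_at_imp_continuous_at_within)
    have "open (- (s ` {1..d}))"
      by (intro open_Compl finite_imp_closed) simp
    then have "\<forall>\<^sub>F x in nhds t. x \<in> - (s ` {1..d})"
      using that by (intro eventually_nhds_in_open) auto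
    then have "\<forall>\<^sub>F x in nhds t. grid_spike s d b x = 0"
      by (rule eventually_mono) (simp add: grid_spike_def)
    from isCont_cong[OF this] show "isCont (grid_spike s d b) t"
      by simp
  qed
  then have "{t \<in> {0..1}. \<not> continuous (at t within {0..1}) (grid_spike s d b)} \<subseteq> s ` {1..d}"
    by blast
  then have "finite {t \<in> {0..1}. \<not> continuous (at t within {0..1}) (grid_spike s d b)}"
    by (rule finite_subset) simp
  ultimately have "grid_spike s d b \<in> E01"
    unfolding E01_def by blast
  then show ?thesis
    using assms by (simp add: E01_nonpos_def) (simp add: grid_spike_def)
qed

lemma sup_norm01_grid_spike_le: "0 \<le> b \<Longrightarrow> b \<le> 1 \<Longrightarrow> sup_norm01 (grid_spike s d b) \<le> 1"
  unfolding sup_norm01_def by (rule cSUP_least) (auto simp: grid_spike_def)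

text \<open>For each outcome the supremum is attained at a grid point: off the grid the product is
  0, which cannot exceed the maximum because \<open>Z\<close> is nonnegative.\<close>

lemma D_norm_grid_spike:
  assumes Z: "generator_process G Z" and s: "\<And>r. r \<in> {1..d} \<Longrightarrow> s r \<in> {0..1}" and d: "1 \<le> d" and b: "0 \<le> b"
  shows "D_norm G Z (grid_spike s d b) = b * grid_max_mean G Z s d"
proof -
  have sup: "(SUP t\<in>{0..1}. \<bar>grid_spike s d b t\<bar> * Z t \<omega>) = b * Max ((\<lambda>r. Z (s r) \<omega>) ` {1..d})"
    if \<omega>: "\<omega> \<in> space G" for \<omega>
  proof (rule cSup_eq_maximum)
    have fin: "finite ((\<lambda>r. Z (s r) \<omega>) ` {1..d})" and ne: "(\<lambda>r. Z (s r) \<omega>) ` {1..d} \<noteq> {}"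
      using d by auto
    have nonneg: "0 \<le> Z t \<omega>" if "t \<in> {0..1}" for t
      using Z \<omega> that unfolding generator_process_def by blast
    obtain r where r: "r \<in> {1..d}" "Max ((\<lambda>r. Z (s r) \<omega>) ` {1..d}) = Z (s r) \<omega>"
      using Max_in[OF fin ne] by auto
    show "b * Max ((\<lambda>r. Z (s r) \<omega>) ` {1..d}) \<in> (\<lambda>t. \<bar>grid_spike s d b t\<bar> * Z t \<omega>) ` {0..1}"
    proof (rule image_eqI)
      show "b * Max ((\<lambda>r. Z (s r) \<omega>) ` {1..d}) = \<bar>grid_spike s d b (s r)\<bar> * Z (s r) \<omega>"
        unfolding r(2) using r(1) b by (simp add: grid_spike_def)
    qed (rule s[OF r(1)])
    fix x
    assume "x \<in> (\<lambda>t. \<bar>grid_spike s d b t\<bar> * Z t \<omega>) ` {0..1}"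
    then obtain t where t: "t \<in> {0..1}" "x = \<bar>grid_spike s d b t\<bar> * Z t \<omega>"
      by auto
    show "x \<le> b * Max ((\<lambda>r. Z (s r) \<omega>) ` {1..d})"
    proof (cases "t \<in> s ` {1..d}")
      case True
      then obtain r' where "r' \<in> {1..d}" "t = s r'"
        by auto
      then have "Z t \<omega> \<le> Max ((\<lambda>r. Z (s r) \<omega>) ` {1..d})"
        using fin by (intro Max_ge) auto
      then show ?thesis
        using t b True by (simp add: grid_spike_def mult_left_mono)
    next
      case False
      have "0 \<le> Max ((\<lambda>r. Z (s r) \<omega>) ` {1..d})"
        unfolding r(2) by (rule nonneg[OF s[OF r(1)]])
      then show ?thesis
        using False t(2) b by (simp add: grid_spike_def)
    qed
  qed
  show ?thesis
    unfolding D_norm_def grid_max_mean_def using sup by (simp cong: Bochner_Integration.integral_cong)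
qed

text \<open>The maximum dominates \<open>Z\<close> at a single grid point, whose mean is 1. This
  lower bound, uniform over all grids, permits dividing by the mean and keeps \<kappa> above
  \<open>n * c\<close>.\<close>

lemma grid_max_mean_ge_1:
  assumes Z: "generator_process G Z" and s: "\<And>r. r \<in> {1..d} \<Longrightarrow> s r \<in> {0..1}" and d: "1 \<le> d"
  shows "1 \<le> grid_max_mean G Z s d"
proof -
  interpret prob_space G
    using Z by (simp add: generator_process_def)
  obtain q where q: "\<And>t \<omega>. t \<in> {0..1} \<Longrightarrow> \<omega> \<in> space G \<Longrightarrow> 0 \<le> Z t \<omega> \<and> Z t \<omega> \<le> q"
    using Z unfolding generator_process_def by blast
  have rv: "Z t \<in> borel_measurable G" and mean: "expectation (Z t) = 1" if "t \<in> {0..1}" for t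
    using Z that by (auto simp: generator_process_def)
  have int: "integrable G (Z t)" if "t \<in> {0..1}" for t
    by (rule integrable_const_bound[where B = q]) (use q rv that in auto)
  let ?max = "\<lambda>\<omega>. Max ((\<lambda>r. Z (s r) \<omega>) ` {1..d})"
  have bounds: "Z (s 1) \<omega> \<le> ?max \<omega>" "?max \<omega> \<le> q" if "\<omega> \<in> space G" for \<omega>
    using q[OF s that] d by (auto intro!: Max_ge)
  have "?max \<in> borel_measurable G"
    using rv s d by (intro borel_measurable_Max) auto
  moreover have "\<bar>?max \<omega>\<bar> \<le> q" if "\<omega> \<in> space G" for \<omega>
  proof -
    have "0 \<le> Z (s 1) \<omega>"
      using q[OF s[of 1] that] d by simp
    then show ?thesis
      using bounds[OF that] by linarith
  qed
  ultimately have "integrable G ?max"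
    by (intro integrable_const_bound[where B = q]) auto
  then have "expectation (Z (s 1)) \<le> expectation ?max"
    using s d bounds by (intro integral_mono int) auto
  then show ?thesis
    using mean[of "s 1"] s[of 1] d by (simp add: grid_max_mean_def)
qed

text \<open>The hypothesis is uniform in the test function, so \<open>K\<close> and the range of
  \<open>c\<close> depend neither on the grid nor on its size nor on \<open>b\<close>. This matters
  because the grid changes with \<open>n\<close>.\<close>

lemma exceed_expansion:
  assumes U: "copula_process M U" "continuous_paths M U" and Z: "generator_process G Z"
    and expansion: "D_norm_expansion M U \<delta> (D_norm G Z)"
  obtains K where "0 \<le> K"
    "\<forall>\<^sub>F c in at_right 0. \<forall>s d b. (\<forall>r\<in>{1..d}. s r \<in> {0..1}) \<longrightarrow> 1 \<le> d \<longrightarrow> 0 \<le> b \<longrightarrow> b \<le> 1 \<longrightarrow>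
      \<bar>(\<integral>\<omega>. exceed s d (c * b) (\<lambda>t. U t \<omega>) \<partial>M) - c * b * grid_max_mean G Z s d\<bar> \<le> K * c powr (1 + \<delta>)"
proof -
  interpret prob_space M
    using U by (simp add: copula_process_def)
  have rv: "U t \<in> borel_measurable M" if "t \<in> {0..1}" for t
    using U(1) that by (simp add: copula_process_def)
  note le_1 = copula_paths_le_1[OF U]
  have exceed_eq: "(\<integral>\<omega>. exceed s d (c * b) (\<lambda>t. U t \<omega>) \<partial>M) =
      1 - measure M {\<omega> \<in> space M. \<forall>t\<in>{0..1}. U t \<omega> \<le> 1 + c * grid_spike s d b t}"
    if s: "\<forall>r\<in>{1..d}. s r \<in> {0..1}" and c: "0 < c" and b: "0 \<le> b" for s d b and c :: real
  proof -
    let ?A = "{\<omega> \<in> space M. \<forall>r\<in>{1..d}. U (s r) \<omega> \<le> 1 - c * b}"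
    have "{\<omega> \<in> space M. \<forall>t\<in>{0..1}. U t \<omega> \<le> 1 + c * grid_spike s d b t} =
        {\<omega> \<in> space M. \<forall>t\<in>{0..1}. U t \<omega> \<le> 1} \<inter> ?A" (is "?B = _")
    proof (intro set_eqI iffI)
      fix \<omega>
      assume "\<omega> \<in> ?B"
      then have *: "\<omega> \<in> space M" "\<And>t. t \<in> {0..1} \<Longrightarrow> U t \<omega> \<le> 1 + c * grid_spike s d b t"
        by auto
      have "U t \<omega> \<le> 1" if "t \<in> {0..1}" for t
      proof -
        have "c * grid_spike s d b t \<le> 0"
          using b c by (simp add: grid_spike_def)
        then show ?thesis
          using *(2)[OF that] by simp
      qed
      moreover have "U (s r) \<omega> \<le> 1 - c * b" if "r \<in> {1..d}" for r
        using *(2)[of "s r"] s that by (simp add: grid_spike_def)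
      ultimately show "\<omega> \<in> {\<omega> \<in> space M. \<forall>t\<in>{0..1}. U t \<omega> \<le> 1} \<inter> ?A"
        using *(1) by simp
    qed (auto simp: grid_spike_def)
    moreover have "?A \<in> sets M"
      by (rule sets.sets_Collect_finite_All) (use s rv in auto)
    ultimately have B: "?B \<in> sets M"
      using le_1(1) by simp
    \<comment> \<open>Almost surely the path stays below or at 1, and then failing to be in
      \<open>?B\<close> means that some grid value exceeds \<open>1 - c * b\<close>.\<close>
    have ae: "AE \<omega> in M. exceed s d (c * b) (\<lambda>t. U t \<omega>) = 1 - indicator ?B \<omega>"
      using le_1(2) AE_space
    proof eventually_elim
      case (elim \<omega>)
      then have "\<omega> \<in> ?B \<longleftrightarrow> (\<forall>r\<in>{1..d}. U (s r) \<omega> \<le> 1 - c * b)"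
        using s by (auto simp: grid_spike_def)
      then show ?case
        by (auto simp: exceed_def not_le indicator_def)
    qed
    have "(\<lambda>\<omega>. exceed s d (c * b) (\<lambda>t. U t \<omega>)) = (\<lambda>\<omega>. of_bool (\<exists>r\<in>{1..d}. 1 - c * b < U (s r) \<omega>))"
      by (simp add: exceed_def)
    also have "\<dots> \<in> borel_measurable M"
      unfolding of_bool_def
    proof (intro measurable_If measurable_const)
      show "{\<omega> \<in> space M. \<exists>r\<in>{1..d}. 1 - c * b < U (s r) \<omega>} \<in> sets M"
        by (rule sets.sets_Collect_finite_Ex) (use s rv in auto)
    qed auto
    finally have "(\<integral>\<omega>. exceed s d (c * b) (\<lambda>t. U t \<omega>) \<partial>M) = (\<integral>\<omega>. 1 - indicator ?B \<omega> \<partial>M)"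
      using ae B by (intro integral_cong_AE) auto
    also have "\<dots> = 1 - measure M ?B"
      using B by (subst Bochner_Integration.integral_diff) (auto simp: prob_space emeasure_eq_measure)
    finally show ?thesis .
  qed
  obtain K where K: "\<forall>\<^sub>F c in at_right 0. \<forall>f\<in>E01_nonpos. sup_norm01 f \<le> 1 \<longrightarrow>
      \<bar>measure M {\<omega> \<in> space M. \<forall>t\<in>{0..1}. U t \<omega> \<le> 1 + c * f t} - (1 - c * D_norm G Z f)\<bar> \<le> K * c powr (1 + \<delta>)"
    using expansion unfolding D_norm_expansion_def by blast
  \<comment> \<open>The sign of \<open>K\<close> in the hypothesis is free, so its absolute value is
    passed on.\<close>
  show ?thesis
  proof (rule that[of "\<bar>K\<bar>"])
    show "\<forall>\<^sub>F c in at_right 0. \<forall>s d b. (\<forall>r\<in>{1..d}. s r \<in> {0..1}) \<longrightarrow> 1 \<le> d \<longrightarrow> 0 \<le> b \<longrightarrow> b \<le> 1 \<longrightarrow>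
      \<bar>(\<integral>\<omega>. exceed s d (c * b) (\<lambda>t. U t \<omega>) \<partial>M) - c * b * grid_max_mean G Z s d\<bar> \<le> \<bar>K\<bar> * c powr (1 + \<delta>)"
      using K eventually_at_right_less[of 0]
    proof eventually_elim
      case (elim c)
      show ?case
      proof (intro allI impI)
        fix s :: "nat \<Rightarrow> real" and d :: nat and b :: real
        assume s: "\<forall>r\<in>{1..d}. s r \<in> {0..1}" and d: "1 \<le> d" and b: "0 \<le> b" "b \<le> 1"
        let ?P = "measure M {\<omega> \<in> space M. \<forall>t\<in>{0..1}. U t \<omega> \<le> 1 + c * grid_spike s d b t}"
        have D: "D_norm G Z (grid_spike s d b) = b * grid_max_mean G Z s d"
          by (rule D_norm_grid_spike[OF Z _ d b(1)]) (use s in blast)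
        have "\<bar>?P - (1 - c * (b * grid_max_mean G Z s d))\<bar> \<le> K * c powr (1 + \<delta>)"
          using elim(1)[rule_format, OF grid_spike_E01_nonpos[OF b(1)] sup_norm01_grid_spike_le[OF b], of s d]
          unfolding D .
        also have "\<dots> \<le> \<bar>K\<bar> * c powr (1 + \<delta>)"
          by (intro mult_right_mono) auto
        finally show "\<bar>(\<integral>\<omega>. exceed s d (c * b) (\<lambda>t. U t \<omega>) \<partial>M) - c * b * grid_max_mean G Z s d\<bar> \<le>
            \<bar>K\<bar> * c powr (1 + \<delta>)"
          unfolding exceed_eq[OF s elim(2) b(1)] by (simp add: mult.assoc abs_minus_commute)
      qed
    qed
  qed simp
qed

section \<open>Moments of weighted exceedances and their errors\<close>

lemma exceed_integrable:
  assumes M: "prob_space M" and U: "\<And>t. t \<in> {0..1} \<Longrightarrow> U t \<in> borel_measurable M"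
    and s: "\<And>r. r \<in> {1..d} \<Longrightarrow> s r \<in> {0..1}"
  shows "integrable M (\<lambda>\<omega>. exceed s d u (\<lambda>t. U t \<omega>))"
proof -
  interpret prob_space M by fact
  have "process_path U \<in> measurable M path_space"
    unfolding process_path_def[abs_def] by (rule measurable_restrict) (rule U)
  moreover have "exceed s d u \<in> borel_measurable path_space"
    by (rule exceed_measurable, erule s)
  ultimately have "(\<lambda>\<omega>. exceed s d u (process_path U \<omega>)) \<in> borel_measurable M"
    by (rule measurable_compose)
  moreover have "exceed s d u (process_path U \<omega>) = exceed s d u (\<lambda>t. U t \<omega>)" for \<omega>
    by (rule exceed_process_path, erule s)
  ultimately have "(\<lambda>\<omega>. exceed s d u (\<lambda>t. U t \<omega>)) \<in> borel_measurable M"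
    by simp
  then show ?thesis
    by (intro integrable_const_bound[where B = 1]) (simp_all add: exceed_def)
qed

lemma weighted_exceed_moments:
  fixes s :: "nat \<Rightarrow> real" and w :: "nat \<Rightarrow> real"
  assumes M: "prob_space M" and U: "\<And>t. t \<in> {0..1} \<Longrightarrow> U t \<in> borel_measurable M"
    and s: "\<And>r. r \<in> {1..d} \<Longrightarrow> s r \<in> {0..1}" and c: "0 \<le> c"
    and p: "\<And>j. p j = (\<integral>\<omega>. exceed s d (c / real j) (\<lambda>t. U t \<omega>) \<partial>M)"
  shows "(\<integral>\<omega>. weighted_exceed w k s d c (process_path U \<omega>) \<partial>M) = (\<Sum>j=1..k. w j * (real j * p j))"
    and "(\<integral>\<omega>. (weighted_exceed w k s d c (process_path U \<omega>))\<^sup>2 \<partial>M) =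
      (\<Sum>j=1..k. \<Sum>l=1..k. w j * w l * real (min j l) * (real (max j l) * p (max j l)))"
proof -
  have int: "integrable M (\<lambda>\<omega>. exceed s d u (\<lambda>t. U t \<omega>))" for u
    by (rule exceed_integrable[OF M], erule U, erule s)
  have path: "weighted_exceed w k s d c (process_path U \<omega>) = weighted_exceed w k s d c (\<lambda>t. U t \<omega>)" for \<omega>
    by (rule weighted_exceed_process_path, erule s)
  show "(\<integral>\<omega>. weighted_exceed w k s d c (process_path U \<omega>) \<partial>M) = (\<Sum>j=1..k. w j * (real j * p j))"
    unfolding path unfolding weighted_exceed_def p using int by (simp add: mult.assoc)
  show "(\<integral>\<omega>. (weighted_exceed w k s d c (process_path U \<omega>))\<^sup>2 \<partial>M) =
      (\<Sum>j=1..k. \<Sum>l=1..k. w j * w l * real (min j l) * (real (max j l) * p (max j l)))"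
    unfolding path unfolding weighted_exceed_square[OF c] p using int by simp
qed

lemma grid_in_unit_interval:
  fixes s :: "nat \<Rightarrow> real"
  assumes ends: "s 1 = 0" "s d = 1" and step: "\<And>i. 1 \<le> i \<Longrightarrow> i < d \<Longrightarrow> s i < s (i + 1)" and r: "r \<in> {1..d}"
  shows "s r \<in> {0..1}"
proof -
  have mono: "s i \<le> s (i + l)" if "1 \<le> i" "i + l \<le> d" for i l
    using that
  proof (induction l)
    case (Suc l)
    then show ?case
      using step[of "i + l"] by simp
  qed simp
  show ?thesis
    using mono[of 1 "r - 1"] mono[of r "d - r"] r ends by simp
qed

text \<open>Dividing the absolute error by the leading term \<open>c * m / j\<close> leaves the
  order \<open>c powr \<delta>\<close>. The second bound controls the bias at the scale of the
  fluctuations and is the source of the condition on \<open>n * c powr (1 + 2 * \<delta>)\<close>;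
  the factor \<open>sqrt m / m\<close> is at most 1.\<close>

lemma relative_error_bounds:
  fixes c m p K \<delta> :: real
  assumes c: "0 < c" and m: "1 \<le> m" and K: "0 \<le> K" and j: "1 \<le> j" "j \<le> k"
    and err: "\<bar>p - c * (1 / real j) * m\<bar> \<le> K * c powr (1 + \<delta>)"
  shows "\<bar>real j * p / (c * m) - 1\<bar> \<le> real k * K * c powr \<delta>"
    and "\<bar>sqrt (real n * c * m) * (real j * p / (c * m) - 1)\<bar> \<le> real k * K * sqrt (real n * c powr (1 + 2 * \<delta>))"
proof -
  have "real j * p / (c * m) - 1 = real j / (c * m) * (p - c * (1 / real j) * m)"
    using c m j by (simp add: field_simps)
  then have "\<bar>real j * p / (c * m) - 1\<bar> = real j / (c * m) * \<bar>p - c * (1 / real j) * m\<bar>"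
    using c m by (simp add: abs_mult)
  also have "\<dots> \<le> real j / (c * m) * (K * c powr (1 + \<delta>))"
    using c m by (intro mult_left_mono err) auto
  also have "\<dots> = real j * K * c powr \<delta> / m"
    using c by (simp add: powr_add)
  finally have le: "\<bar>real j * p / (c * m) - 1\<bar> \<le> real j * K * c powr \<delta> / m" .
  have jk: "real j * K * c powr \<delta> \<le> real k * K * c powr \<delta>"
    using j K by (intro mult_right_mono) auto
  have "real j * K * c powr \<delta> / m \<le> real j * K * c powr \<delta>"
    using m K by (intro divide_left_mono[where b = 1, simplified] ) auto
  with le jk show "\<bar>real j * p / (c * m) - 1\<bar> \<le> real k * K * c powr \<delta>"
    by linarith
  have "sqrt m \<le> m"
    using m by (intro real_le_lsqrt) (auto simp: power2_eq_square mult_left_le)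
  then have sqrt_m: "sqrt m / m \<le> 1"
    using m by simp
  have "(c powr \<delta>)\<^sup>2 = c powr (2 * \<delta>)"
    by (simp add: power2_eq_square flip: powr_add)
  then have "c powr (1 + 2 * \<delta>) = c * (c powr \<delta>)\<^sup>2"
    using c by (simp add: powr_add)
  then have sqrt_eq: "sqrt (real n * c powr (1 + 2 * \<delta>)) = sqrt (real n * c) * c powr \<delta>"
    by (simp add: real_sqrt_mult mult.assoc)
  have "\<bar>sqrt (real n * c * m) * (real j * p / (c * m) - 1)\<bar> \<le> sqrt (real n * c * m) * (real j * K * c powr \<delta> / m)"
    using mult_left_mono[OF le, of "sqrt (real n * c * m)"] c m by (simp add: abs_mult)
  also have "\<dots> = (real j * K * sqrt (real n * c powr (1 + 2 * \<delta>))) * (sqrt m / m)"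
    unfolding sqrt_eq by (simp add: real_sqrt_mult)
  also have "\<dots> \<le> (real j * K * sqrt (real n * c powr (1 + 2 * \<delta>))) * 1"
    using K c by (intro mult_left_mono sqrt_m) auto
  also have "\<dots> \<le> real k * K * sqrt (real n * c powr (1 + 2 * \<delta>))"
    using K j c by (simp add: mult_right_mono)
  finally show "\<bar>sqrt (real n * c * m) * (real j * p / (c * m) - 1)\<bar> \<le>
      real k * K * sqrt (real n * c powr (1 + 2 * \<delta>))" .
qed

section \<open>The limit of the test statistic\<close>

theorem theorem6p1:
  fixes M :: "'a measure" and U :: "real \<Rightarrow> 'a \<Rightarrow> real"
    and G :: "'g measure" and Z :: "real \<Rightarrow> 'g \<Rightarrow> real"
    and N :: "'b measure" and X :: "nat \<Rightarrow> real \<Rightarrow> 'b \<Rightarrow> real"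
    and Q :: "'q measure" and \<xi> :: "nat \<Rightarrow> 'q \<Rightarrow> real"
    and \<delta> :: real and d :: "nat \<Rightarrow> nat" and t :: "nat \<Rightarrow> nat \<Rightarrow> real"
    and k :: nat and c :: "nat \<Rightarrow> real"
  assumes U: "copula_process M U" "continuous_paths M U"
    and \<delta>: "\<delta> > 0"
    and Z: "generator_process G Z"
    and expansion: "D_norm_expansion M U \<delta> (D_norm G Z)"
    and d: "\<And>n. d n \<ge> 2" "filterlim d at_top sequentially"
    and grid: "\<And>n. t (d n) 1 = 0" "\<And>n. t (d n) (d n) = 1"
      "\<And>n i. 1 \<le> i \<Longrightarrow> i < d n \<Longrightarrow> t (d n) i < t (d n) (i + 1)"
    and mesh: "(\<lambda>n. MAX i\<in>{1..d n - 1}. \<bar>t (d n) (i + 1) - t (d n) i\<bar>) \<longlonglongrightarrow> 0"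
    and k: "k \<ge> 1"
    and X: "independent_copies N X M U"
    and c: "\<And>n. 0 < c n" "\<And>n. c n < 1" "c \<longlonglongrightarrow> 0"
      "filterlim (\<lambda>n. real n * c n) at_top sequentially"
      "(\<lambda>n. real n * c n powr (1 + 2 * \<delta>)) \<longlonglongrightarrow> 0"
    and Q: "prob_space Q"
    and \<xi>: "prob_space.indep_vars Q (\<lambda>_. borel) \<xi> {1..k - 1}"
      "\<And>i. i \<in> {1..k - 1} \<Longrightarrow> distributed Q lborel (\<xi> i) std_normal_density"
  shows "weak_conv_m
    (\<lambda>n. distr N borel (\<lambda>\<omega>. test_statistic k (\<lambda>i s. X i s \<omega>) n (t (d n)) (d n) (c n)))
    (distr Q borel (\<lambda>\<omega>. \<Sum>i=1..k - 1.
        1 / (4 * (sin (real i / real k * (pi / 2)))\<^sup>2) * (\<xi> i \<omega>)\<^sup>2))"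
proof -

  \<comment> \<open>Normalization of the counts\<close>
  interpret M: prob_space M
    using U by (simp add: copula_process_def)
  interpret N: prob_space N
    using X by (simp add: independent_copies_def)
  have rv: "U s \<in> borel_measurable M" if "s \<in> {0..1}" for s
    using U(1) that by (simp add: copula_process_def)
  have grid01: "t (d n) r \<in> {0..1}" if "r \<in> {1..d n}" for n r
    by (rule grid_in_unit_interval[OF grid(1,2) _ that]) (rule grid(3))
  define m where "m n = grid_max_mean G Z (t (d n)) (d n)" for n
  define \<kappa> where "\<kappa> n = real n * c n * m n" for n
  define p where "p n j = (\<integral>\<omega>. exceed (t (d n)) (d n) (c n / real j) (\<lambda>s. U s \<omega>) \<partial>M)" for n j
  \<comment> \<open>The relative error of \<open>p n j\<close> with respect to its leading term, so
    that each \<open>j\<close>-fold count has mean \<open>\<kappa> n * (1 + e n j)\<close>.\<close>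
  define e where "e n j = real j * p n j / (c n * m n) - 1" for n j
  define H where "H w n = weighted_exceed w k (t (d n)) (d n) (c n)" for w n
  have m: "1 \<le> m n" for n
    unfolding m_def using grid01 d(1)[of n] by (intro grid_max_mean_ge_1[OF Z]) auto
  have \<kappa>_pos: "0 < \<kappa> n" if "1 \<le> n" for n
    using that c(1)[of n] m[of n] by (simp add: \<kappa>_def)
  have \<kappa>_nonneg: "0 \<le> \<kappa> n" for n
    using c(1)[of n] m[of n] by (simp add: \<kappa>_def)
  have \<kappa>_top: "filterlim \<kappa> at_top sequentially"
  proof (rule filterlim_at_top_mono[OF c(4)])
    have "real n * c n * 1 \<le> \<kappa> n" for n
      unfolding \<kappa>_def using c(1)[of n] m[of n] by (intro mult_left_mono) auto
    then show "\<forall>\<^sub>F n in sequentially. real n * c n \<le> \<kappa> n"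
      by simp
  qed
  have sqrt_\<kappa>_top: "filterlim (\<lambda>n. sqrt (\<kappa> n)) at_top sequentially"
    by (rule filterlim_compose[OF sqrt_at_top \<kappa>_top])
  have jp: "real j * p n j = c n * m n * (1 + e n j)" for n j
    using c(1)[of n] m[of n] by (simp add: e_def)

  \<comment> \<open>Vanishing of the relative errors\<close>
  obtain K where K: "0 \<le> K" "\<forall>\<^sub>F c in at_right 0. \<forall>s d b. (\<forall>r\<in>{1..d}. s r \<in> {0..1}) \<longrightarrow> 1 \<le> d \<longrightarrow> 0 \<le> b \<longrightarrow> b \<le> 1 \<longrightarrow>
      \<bar>(\<integral>\<omega>. exceed s d (c * b) (\<lambda>t. U t \<omega>) \<partial>M) - c * b * grid_max_mean G Z s d\<bar> \<le> K * c powr (1 + \<delta>)"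
    using exceed_expansion[OF U Z expansion] by blast
  have "filterlim c (at_right 0) sequentially"
    using c(1,3) by (intro tendsto_imp_filterlim_at_right) auto
  with K(2) have "\<forall>\<^sub>F n in sequentially. \<forall>s d b. (\<forall>r\<in>{1..d}. s r \<in> {0..1}) \<longrightarrow> 1 \<le> d \<longrightarrow> 0 \<le> b \<longrightarrow> b \<le> 1 \<longrightarrow>
      \<bar>(\<integral>\<omega>. exceed s d (c n * b) (\<lambda>t. U t \<omega>) \<partial>M) - c n * b * grid_max_mean G Z s d\<bar> \<le> K * c n powr (1 + \<delta>)"
    by (rule eventually_compose_filterlim)
  then have err: "\<forall>\<^sub>F n in sequentially. \<bar>p n j - c n * (1 / real j) * m n\<bar> \<le> K * c n powr (1 + \<delta>)"
    if "j \<in> {1..k}" for j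
  proof eventually_elim
    case (elim n)
    \<comment> \<open>The spike height \<open>1 / j\<close> turns the level \<open>c n\<close> into
      the level \<open>c n / j\<close> of the \<open>j\<close>-th count.\<close>
    show ?case
      using elim[rule_format, of "d n" "t (d n)" "1 / real j"] grid01[of _ n] d(1)[of n] that
      by (simp add: p_def m_def)
  qed
  have e_lim: "(\<lambda>n. e n j) \<longlonglongrightarrow> 0" and sqrt_e_lim: "(\<lambda>n. sqrt (\<kappa> n) * e n j) \<longlonglongrightarrow> 0"
    if j: "j \<in> {1..k}" for j
  proof -
    have j': "1 \<le> j" "j \<le> k"
      using j by auto
    have "(\<lambda>n. c n powr \<delta>) \<longlonglongrightarrow> 0"
      using c(1,3) \<delta> by (intro tendsto_zero_powrI[where b = \<delta>]) (auto simp: less_imp_le)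
    then have lim: "(\<lambda>n. real k * K * c n powr \<delta>) \<longlonglongrightarrow> 0"
      by (rule tendsto_mult_right_zero)
    show "(\<lambda>n. e n j) \<longlonglongrightarrow> 0"
      by (rule Lim_null_comparison[OF _ lim], rule eventually_mono[OF err[OF j]])
        (simp only: e_def real_norm_def relative_error_bounds(1)[OF c(1) m K(1) j'])
    have "(\<lambda>n. sqrt (real n * c n powr (1 + 2 * \<delta>))) \<longlonglongrightarrow> 0"
      using tendsto_real_sqrt[OF c(5)] by simp
    then have lim: "(\<lambda>n. real k * K * sqrt (real n * c n powr (1 + 2 * \<delta>))) \<longlonglongrightarrow> 0"
      by (rule tendsto_mult_right_zero)
    show "(\<lambda>n. sqrt (\<kappa> n) * e n j) \<longlonglongrightarrow> 0"
      by (rule Lim_null_comparison[OF _ lim], rule eventually_mono[OF err[OF j]])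
        (simp only: e_def \<kappa>_def real_norm_def relative_error_bounds(2)[OF c(1) m K(1) j'])
  qed

  \<comment> \<open>Independence, law and moments of linear forms in the counts\<close>
  have indep_path: "N.indep_vars (\<lambda>_. borel) (\<lambda>i \<omega>. f (process_path (X i) \<omega>)) {1..n}"
    if "f \<in> borel_measurable path_space" for f :: "(real \<Rightarrow> real) \<Rightarrow> real" and n
    by (rule independent_copies_functional(1)[OF X that], erule rv)
  have law_path: "distr N borel (\<lambda>\<omega>. f (process_path (X i) \<omega>)) = distr M borel (\<lambda>\<omega>. f (process_path U \<omega>))"
    if "f \<in> borel_measurable path_space" "1 \<le> i" for f :: "(real \<Rightarrow> real) \<Rightarrow> real" and i
    by (rule independent_copies_functional(2)[OF X that(1) _ that(2)], erule rv)
  have meas_path: "(\<lambda>\<omega>. f (process_path (X i) \<omega>)) \<in> borel_measurable N"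
    if "f \<in> borel_measurable path_space" "i \<in> {1..n}" for f :: "(real \<Rightarrow> real) \<Rightarrow> real" and i n
    using indep_path[OF that(1), of n] that(2) unfolding N.indep_vars_def2 by blast
  have H_meas: "H w n \<in> borel_measurable path_space" for w n
    unfolding H_def by (rule weighted_exceed_measurable, erule grid01)
  have U_meas: "process_path U \<in> measurable M path_space"
    unfolding process_path_def[abs_def] by (rule measurable_restrict) (rule rv)
  have H_path: "H w n (process_path (X i) \<omega>) = H w n (\<lambda>s. X i s \<omega>)" for w n i \<omega>
    unfolding H_def by (rule weighted_exceed_process_path, erule grid01)
  have H_abs: "\<bar>H w n x\<bar> \<le> (\<Sum>j=1..k. \<bar>w j\<bar> * real j)" for w n x
    unfolding H_def by (rule abs_weighted_exceed_le)
  have H_sum: "(\<Sum>i=1..n. H w n (\<lambda>s. X i s \<omega>)) =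
      (\<Sum>j=1..k. w j * (real j * exceedances (\<lambda>i s. X i s \<omega>) n (t (d n)) (d n) (c n) j))" for w n \<omega>
    unfolding H_def by (rule sum_weighted_exceed)
  have mean_H: "real n * (\<integral>\<omega>. H w n (process_path U \<omega>) \<partial>M) = \<kappa> n * (\<Sum>j=1..k. w j * (1 + e n j))" for w n
  proof -
    have "(\<integral>\<omega>. H w n (process_path U \<omega>) \<partial>M) =
        (\<Sum>j=1..k. w j * (real j * p n j))"
      unfolding H_def
      by (rule weighted_exceed_moments(1)[OF M.prob_space_axioms], erule rv, erule grid01,
          rule less_imp_le[OF c(1)], rule p_def)
    then show ?thesis
      unfolding jp \<kappa>_def by (simp add: sum_distrib_left mult_ac)
  qed
  have square_H: "real n * (\<integral>\<omega>. (H w n (process_path U \<omega>))\<^sup>2 \<partial>M) =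
      \<kappa> n * (\<Sum>j=1..k. \<Sum>l=1..k. w j * w l * real (min j l) * (1 + e n (max j l)))" for w n
  proof -
    have "(\<integral>\<omega>. (H w n (process_path U \<omega>))\<^sup>2 \<partial>M) =
        (\<Sum>j=1..k. \<Sum>l=1..k. w j * w l * real (min j l) * (real (max j l) * p n (max j l)))"
      unfolding H_def
      by (rule weighted_exceed_moments(2)[OF M.prob_space_axioms], erule rv, erule grid01,
          rule less_imp_le[OF c(1)], rule p_def)
    then show ?thesis
      unfolding jp \<kappa>_def by (simp add: sum_distrib_left mult_ac)
  qed
  have square_lim: "(\<lambda>n. \<Sum>j=1..k. \<Sum>l=1..k. w j * w l * real (min j l) * (1 + e n (max j l))) \<longlonglongrightarrow>
      (\<Sum>j=1..k. \<Sum>l=1..k. w j * w l * real (min j l))" for w :: "nat \<Rightarrow> real"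
  proof (intro tendsto_sum)
    fix j l
    assume "j \<in> {1..k}" "l \<in> {1..k}"
    then have "(\<lambda>n. w j * w l * real (min j l) * (1 + e n (max j l))) \<longlonglongrightarrow> w j * w l * real (min j l) * (1 + 0)"
      by (intro tendsto_mult tendsto_add tendsto_const e_lim) auto
    then show "(\<lambda>n. w j * w l * real (min j l) * (1 + e n (max j l))) \<longlonglongrightarrow> w j * w l * real (min j l)"
      by simp
  qed

  \<comment> \<open>The means of the summands are of order \<open>sqrt (\<kappa> n)\<close> and
    diverge, but their leading parts coincide, so weights of sum zero remove them. What remains is
    the bias \<open>sqrt (\<kappa> n) * e n j\<close>, which tends to 0.\<close>
  have clt: "(\<lambda>n. CLINT \<omega>|N. iexp (\<Sum>j=1..k. w j *
        (real j * exceedances (\<lambda>i s. X i s \<omega>) n (t (d n)) (d n) (c n) j / sqrt (\<kappa> n)))) \<longlonglongrightarrow>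
      of_real (exp (- (\<Sum>j=1..k. \<Sum>l=1..k. w j * w l * real (min j l)) / 2))"
    if w: "(\<Sum>j=1..k. w j) = 0" for w :: "nat \<Rightarrow> real"
  proof -
    define h where "h n x = H w n x / sqrt (\<kappa> n)" for n x
    define \<mu> where "\<mu> n = distr M borel (\<lambda>\<omega>. h n (process_path U \<omega>))" for n
    define v where "v = (\<Sum>j=1..k. \<Sum>l=1..k. w j * w l * real (min j l))"
    have h_meas: "h n \<in> borel_measurable path_space" for n
      unfolding h_def[abs_def] using H_meas by simp
    note hU_meas = measurable_compose[OF U_meas h_meas]
    have "(\<lambda>n. char (distr N borel (\<lambda>\<omega>. \<Sum>i=1..n. h n (process_path (X i) \<omega>))) 1) \<longlonglongrightarrow> exp (\<i> * (0::real) - v / 2)"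
    proof (rule N.char_triangular_array_tendsto[where \<mu> = \<mu> and B = "\<lambda>n. (\<Sum>j=1..k. \<bar>w j\<bar> * real j) / sqrt (\<kappa> n)"])
      show "N.indep_vars (\<lambda>_. borel) (\<lambda>i \<omega>. h n (process_path (X i) \<omega>)) {1..n}" for n
        by (rule indep_path[OF h_meas])
      show "distr N borel (\<lambda>\<omega>. h n (process_path (X i) \<omega>)) = \<mu> n" if "i \<in> {1..n}" for n i
        unfolding \<mu>_def by (rule law_path[OF h_meas]) (use that in auto)
      show "real_distribution (\<mu> n)" for n
        unfolding \<mu>_def by (rule M.real_distribution_distr) (rule hU_meas)
      show "AE x in \<mu> n. \<bar>x\<bar> \<le> (\<Sum>j=1..k. \<bar>w j\<bar> * real j) / sqrt (\<kappa> n)" for n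
        unfolding \<mu>_def using hU_meas[of n] H_abs \<kappa>_nonneg
        by (subst AE_distr_iff) (auto simp: h_def intro!: divide_right_mono AE_I2)
      show "(\<lambda>n. (\<Sum>j=1..k. \<bar>w j\<bar> * real j) / sqrt (\<kappa> n)) \<longlonglongrightarrow> 0"
        by (rule real_tendsto_divide_at_top[OF tendsto_const sqrt_\<kappa>_top])
      have "real n * (\<integral>x. x \<partial>\<mu> n) = (\<Sum>j=1..k. w j * (sqrt (\<kappa> n) * e n j))" for n
      proof -
        have "real n * (\<integral>x. x \<partial>\<mu> n) = real n * (\<integral>\<omega>. H w n (process_path U \<omega>) \<partial>M) / sqrt (\<kappa> n)"
          unfolding \<mu>_def using hU_meas[of n] by (simp add: integral_distr) (simp add: h_def)
        also have "\<dots> = sqrt (\<kappa> n) * (\<Sum>j=1..k. w j * (1 + e n j))"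
          unfolding mean_H using \<kappa>_nonneg[of n] real_div_sqrt[of "\<kappa> n"] by (metis times_divide_eq_left)
        also have "\<dots> = sqrt (\<kappa> n) * (\<Sum>j=1..k. w j * e n j)"
          using w by (simp add: distrib_left sum.distrib)
        finally show ?thesis
          by (simp add: sum_distrib_left mult_ac)
      qed
      moreover have "(\<lambda>n. \<Sum>j=1..k. w j * (sqrt (\<kappa> n) * e n j)) \<longlonglongrightarrow> (\<Sum>j=1..k. w j * 0)"
        by (intro tendsto_sum tendsto_mult tendsto_const sqrt_e_lim)
      ultimately show "(\<lambda>n. real n * (\<integral>x. x \<partial>\<mu> n)) \<longlonglongrightarrow> 0"
        by simp
      \<comment> \<open>Only from \<open>n = 1\<close> on: \<open>\<kappa> 0\<close> is 0 and cannot
        be cancelled.\<close>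
      have "real n * (\<integral>x. x\<^sup>2 \<partial>\<mu> n) = (\<Sum>j=1..k. \<Sum>l=1..k. w j * w l * real (min j l) * (1 + e n (max j l)))"
        if "1 \<le> n" for n
      proof -
        have "real n * (\<integral>x. x\<^sup>2 \<partial>\<mu> n) = real n * (\<integral>\<omega>. (H w n (process_path U \<omega>))\<^sup>2 \<partial>M) / \<kappa> n"
          unfolding \<mu>_def using hU_meas[of n] \<kappa>_nonneg[of n]
          by (simp add: integral_distr) (simp add: h_def power_divide)
        then show ?thesis
          unfolding square_H using \<kappa>_pos[OF that] by simp
      qed
      then have "\<forall>\<^sub>F n in sequentially. (\<Sum>j=1..k. \<Sum>l=1..k. w j * w l * real (min j l) * (1 + e n (max j l))) =
          real n * (\<integral>x. x\<^sup>2 \<partial>\<mu> n)"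
        by (intro eventually_sequentiallyI[of 1]) simp
      from Lim_transform_eventually[OF square_lim this] show "(\<lambda>n. real n * (\<integral>x. x\<^sup>2 \<partial>\<mu> n)) \<longlonglongrightarrow> v"
        by (simp add: v_def)
    qed
    moreover have "char (distr N borel (\<lambda>\<omega>. \<Sum>i=1..n. h n (process_path (X i) \<omega>))) 1 =
        (CLINT \<omega>|N. iexp (\<Sum>j=1..k. w j *
          (real j * exceedances (\<lambda>i s. X i s \<omega>) n (t (d n)) (d n) (c n) j / sqrt (\<kappa> n))))" for n
    proof -
      have sum: "(\<Sum>i=1..n. h n (process_path (X i) \<omega>)) = (\<Sum>j=1..k. w j *
          (real j * exceedances (\<lambda>i s. X i s \<omega>) n (t (d n)) (d n) (c n) j / sqrt (\<kappa> n)))" for \<omega>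
        by (simp only: h_def H_path H_sum sum_divide_distrib[symmetric] times_divide_eq_right)
      have "(\<lambda>\<omega>. h n (process_path (X i) \<omega>)) \<in> borel_measurable N" if "i \<in> {1..n}" for i
        by (rule meas_path[OF h_meas that])
      then have "(\<lambda>\<omega>. \<Sum>i=1..n. h n (process_path (X i) \<omega>)) \<in> borel_measurable N"
        by (rule borel_measurable_sum)
      then have "char (distr N borel (\<lambda>\<omega>. \<Sum>i=1..n. h n (process_path (X i) \<omega>))) 1 =
          (CLINT \<omega>|N. iexp (\<Sum>i=1..n. h n (process_path (X i) \<omega>)))"
        by (simp add: char_def integral_distr)
      then show ?thesis
        by (simp only: sum)
    qed
    ultimately show ?thesis
      by (simp add: v_def exp_of_real[symmetric])
  qed

  \<comment> \<open>The statistic as a normalized quadratic form\<close>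
  define F where "F n i \<omega> = (\<Sum>j=1..k. dct k i j *
      (real j * exceedances (\<lambda>i s. X i s \<omega>) n (t (d n)) (d n) (c n) j / sqrt (\<kappa> n)))" for n i \<omega>
  define A where "A n \<omega> = (1 / real k) * (\<Sum>l=1..k. real l * exceedances (\<lambda>i s. X i s \<omega>) n (t (d n)) (d n) (c n) l) / \<kappa> n"
    for n \<omega>
  let ?\<rho> = "\<lambda>i. 1 / (4 * (sin (real i / real k * (pi / 2)))\<^sup>2)"
  have statistic: "test_statistic k (\<lambda>i s. X i s \<omega>) n (t (d n)) (d n) (c n) = (\<Sum>i=1..k - 1. (F n i \<omega>)\<^sup>2) / A n \<omega>"
    for n \<omega>
  \<comment> \<open>For \<open>n = 0\<close> all counts vanish, and both sides are 0 by division by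
    zero. Otherwise the factor \<open>1 / \<kappa> n\<close> in the squares of \<open>F\<close> and
    in \<open>A\<close> cancels.\<close>
  proof (cases "n = 0")
    case True
    then show ?thesis
      by (simp add: test_statistic_def A_def \<kappa>_def exceedances_def)
  next
    case False
    then have \<kappa>: "0 < \<kappa> n"
      using \<kappa>_pos by simp
    define x where "x j = real j * exceedances (\<lambda>i s. X i s \<omega>) n (t (d n)) (d n) (c n) j" for j
    have "(\<Sum>i=1..k - 1. (F n i \<omega>)\<^sup>2) = (\<Sum>j=1..k. (x j / sqrt (\<kappa> n) - (\<Sum>l=1..k. x l / sqrt (\<kappa> n)) / real k)\<^sup>2)"
      unfolding F_def x_def by (rule dct_parseval)
    also have "\<dots> = (\<Sum>j=1..k. ((x j - (1 / real k) * (\<Sum>l=1..k. x l)) / sqrt (\<kappa> n))\<^sup>2)"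
      by (simp add: sum_divide_distrib[symmetric] diff_divide_distrib mult.commute)
    also have "\<dots> = (\<Sum>j=1..k. (x j - (1 / real k) * (\<Sum>l=1..k. x l))\<^sup>2) / \<kappa> n"
      using \<kappa> by (simp add: power_divide flip: sum_divide_distrib)
    finally have "(\<Sum>i=1..k - 1. (F n i \<omega>)\<^sup>2) = (\<Sum>j=1..k. (x j - (1 / real k) * (\<Sum>l=1..k. x l))\<^sup>2) / \<kappa> n" .
    then show ?thesis
      using \<kappa> by (simp add: test_statistic_def Let_def A_def flip: x_def)
  qed

  have exc_meas: "(\<lambda>\<omega>. exceedances (\<lambda>i s. X i s \<omega>) n (t (d n)) (d n) (c n) j) \<in> borel_measurable N" for n j
  proof -
    have "(\<lambda>\<omega>. exceed (t (d n)) (d n) (c n / real j) (process_path (X i) \<omega>)) \<in> borel_measurable N"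
      if "i \<in> {1..n}" for i
      by (rule meas_path[OF _ that], rule exceed_measurable, erule grid01)
    then have "(\<lambda>\<omega>. \<Sum>i=1..n. exceed (t (d n)) (d n) (c n / real j) (process_path (X i) \<omega>)) \<in> borel_measurable N"
      by (rule borel_measurable_sum)
    moreover have "exceed (t (d n)) (d n) u (process_path (X i) \<omega>) = exceed (t (d n)) (d n) u (\<lambda>s. X i s \<omega>)" for u i \<omega>
      by (rule exceed_process_path, erule grid01)
    ultimately show ?thesis
      by (simp only: exceedances_eq)
  qed
  have F_meas: "F n i \<in> borel_measurable N" for n i
    unfolding F_def[abs_def]
    by (intro borel_measurable_sum borel_measurable_times borel_measurable_divide borel_measurable_const exc_meas)
  have char_F: "(\<lambda>n. CLINT \<omega>|N. iexp (\<Sum>i=1..k - 1. a i * F n i \<omega>)) \<longlonglongrightarrow>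
      of_real (exp (- (\<Sum>i=1..k - 1. ?\<rho> i * (a i)\<^sup>2) / 2))" for a :: "nat \<Rightarrow> real"
  proof -
    \<comment> \<open>A linear form in the cosine coefficients is one in the counts, with weights of
      sum zero because every cosine vector involved has sum zero.\<close>
    define w where "w j = (\<Sum>i=1..k - 1. a i * dct k i j)" for j
    have "(\<Sum>j=1..k. w j) = (\<Sum>i=1..k - 1. a i * (\<Sum>j=1..k. dct k i j))"
      unfolding w_def sum_distrib_left by (rule sum.swap)
    also have "\<dots> = 0"
      by (intro sum.neutral ballI) (simp only: dct_sum_eq_0 mult_zero_right)
    finally have "(\<Sum>j=1..k. w j) = 0" .
    note clt[OF this]
    moreover have "(\<Sum>j=1..k. \<Sum>l=1..k. w j * w l * real (min j l)) = (\<Sum>i=1..k - 1. ?\<rho> i * (a i)\<^sup>2)"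
      unfolding w_def by (rule min_form_dct_combination)
    moreover have "(\<Sum>j=1..k. w j * x j) = (\<Sum>i=1..k - 1. a i * (\<Sum>j=1..k. dct k i j * x j))" for x :: "nat \<Rightarrow> real"
      unfolding w_def sum_distrib_left sum_distrib_right mult.assoc by (rule sum.swap)
    ultimately show ?thesis
      by (simp only: F_def)
  qed
  have A_nonneg: "0 \<le> A n \<omega>" for n \<omega>
    using \<kappa>_nonneg[of n] by (auto simp: A_def exceedances_def intro!: divide_nonneg_nonneg sum_nonneg mult_nonneg_nonneg)

  \<comment> \<open>Convergence of the denominator to 1\<close>
  define w where "w j = 1 / real k" for j :: nat
  define h where "h n x = H w n x / \<kappa> n" for n x
  have h_meas: "h n \<in> borel_measurable path_space" for n
    unfolding h_def[abs_def] using H_meas by simp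
  have A_eq: "A n = (\<lambda>\<omega>. \<Sum>i=1..n. h n (process_path (X i) \<omega>))" for n
  proof
    fix \<omega>
    show "A n \<omega> = (\<Sum>i=1..n. h n (process_path (X i) \<omega>))"
      by (simp only: A_def h_def H_path H_sum sum_divide_distrib[symmetric] w_def sum_distrib_left[symmetric])
  qed
  note hX_meas = meas_path[OF h_meas]
  have hU_meas: "(\<lambda>\<omega>. h n (process_path U \<omega>)) \<in> borel_measurable M" for n
    by (rule measurable_compose[OF U_meas h_meas])
  have h_bounded: "\<bar>h n x\<bar> \<le> (\<Sum>j=1..k. \<bar>w j\<bar> * real j) / \<kappa> n" for n x
    unfolding h_def using H_abs[of w n x] \<kappa>_nonneg[of n] by (simp add: divide_right_mono)
  have int_h: "integrable N (\<lambda>\<omega>. h n (process_path (X i) \<omega>))" if "i \<in> {1..n}" for n i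
    by (rule N.integrable_const_bound) (use h_bounded hX_meas[OF that] in auto)
  have int_h2: "integrable N (\<lambda>\<omega>. (h n (process_path (X i) \<omega>))\<^sup>2)" if "i \<in> {1..n}" for n i
  proof (rule N.integrable_const_bound)
    have "(h n x)\<^sup>2 \<le> ((\<Sum>j=1..k. \<bar>w j\<bar> * real j) / \<kappa> n)\<^sup>2" for x
      using power_mono[OF h_bounded[of n x], of 2] by simp
    then show "AE \<omega> in N. norm ((h n (process_path (X i) \<omega>))\<^sup>2) \<le> ((\<Sum>j=1..k. \<bar>w j\<bar> * real j) / \<kappa> n)\<^sup>2"
      by simp
  qed (use hX_meas[OF that] in simp)
  have A_int: "integrable N (A n)" for n
    unfolding A_eq by (intro Bochner_Integration.integrable_sum int_h)
  have h_integral: "(\<integral>\<omega>. f (h n (process_path (X i) \<omega>)) \<partial>N) = (\<integral>\<omega>. f (h n (process_path U \<omega>)) \<partial>M)"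
    if "i \<in> {1..n}" and f: "f \<in> borel_measurable borel" for n i and f :: "real \<Rightarrow> real"
  proof -
    have "(\<integral>\<omega>. f (h n (process_path (X i) \<omega>)) \<partial>N) = integral\<^sup>L (distr N borel (\<lambda>\<omega>. h n (process_path (X i) \<omega>))) f"
      by (rule integral_distr[OF hX_meas[OF that(1)] f, symmetric])
    also have "distr N borel (\<lambda>\<omega>. h n (process_path (X i) \<omega>)) = distr M borel (\<lambda>\<omega>. h n (process_path U \<omega>))"
      by (rule law_path[OF h_meas]) (use that(1) in simp)
    also have "integral\<^sup>L \<dots> f = (\<integral>\<omega>. f (h n (process_path U \<omega>)) \<partial>M)"
      by (rule integral_distr[OF hU_meas f])
    finally show ?thesis .
  qed
  have dev: "(\<integral>\<omega>. \<bar>A n \<omega> - 1\<bar> \<partial>N) \<le>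
      sqrt (real n * (\<integral>\<omega>. (h n (process_path U \<omega>))\<^sup>2 \<partial>M)) + \<bar>real n * (\<integral>\<omega>. h n (process_path U \<omega>) \<partial>M) - 1\<bar>" for n
    using N.indep_sum_mean_abs_deviation[OF _ indep_path[OF h_meas], of n n 1] int_h2
      h_integral[of _ n "\<lambda>x. x\<^sup>2"] h_integral[of _ n "\<lambda>x. x"] by (simp add: A_eq)
  have L1: "(\<lambda>n. \<integral>\<omega>. \<bar>A n \<omega> - 1\<bar> \<partial>N) \<longlonglongrightarrow> 0"
  proof (rule tendsto_sandwich[OF _ _ tendsto_const])
    \<comment> \<open>The summed second moments equal \<open>?q n / \<kappa> n\<close>, with bounded
      \<open>?q\<close> against diverging \<kappa>. The mean \<open>?l n\<close> of
      \<open>A n\<close> tends to the sum of the weights, which is 1 here.\<close>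
    let ?q = "\<lambda>n. \<Sum>j=1..k. \<Sum>l=1..k. w j * w l * real (min j l) * (1 + e n (max j l))"
    let ?l = "\<lambda>n. \<Sum>j=1..k. w j * (1 + e n j)"
    have "(\<integral>\<omega>. \<bar>A n \<omega> - 1\<bar> \<partial>N) \<le> sqrt (?q n / \<kappa> n) + \<bar>?l n - 1\<bar>" if "1 \<le> n" for n
    proof -
      note \<kappa> = \<kappa>_pos[OF that]
      have "real n * (\<integral>\<omega>. h n (process_path U \<omega>) \<partial>M) = real n * (\<integral>\<omega>. H w n (process_path U \<omega>) \<partial>M) / \<kappa> n"
        by (simp add: h_def)
      then have "real n * (\<integral>\<omega>. h n (process_path U \<omega>) \<partial>M) = ?l n"
        unfolding mean_H using \<kappa> by simp
      moreover have "real n * (\<integral>\<omega>. (h n (process_path U \<omega>))\<^sup>2 \<partial>M) =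
          real n * (\<integral>\<omega>. (H w n (process_path U \<omega>))\<^sup>2 \<partial>M) / \<kappa> n / \<kappa> n"
        by (simp add: h_def power_divide power2_eq_square)
      then have "real n * (\<integral>\<omega>. (h n (process_path U \<omega>))\<^sup>2 \<partial>M) = ?q n / \<kappa> n"
        unfolding square_H using \<kappa> by simp
      ultimately show ?thesis
        using dev[of n] by simp
    qed
    then show "\<forall>\<^sub>F n in sequentially. (\<integral>\<omega>. \<bar>A n \<omega> - 1\<bar> \<partial>N) \<le> sqrt (?q n / \<kappa> n) + \<bar>?l n - 1\<bar>"
      by (intro eventually_sequentiallyI[of 1])
    have "(\<lambda>n. ?q n / \<kappa> n) \<longlonglongrightarrow> 0"
      by (rule real_tendsto_divide_at_top[OF square_lim \<kappa>_top])
    moreover have "?l \<longlonglongrightarrow> (\<Sum>j=1..k. w j * (1 + 0))"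
      by (intro tendsto_sum tendsto_mult tendsto_add tendsto_const e_lim)
    then have "?l \<longlonglongrightarrow> 1"
      using k by (simp add: w_def)
    ultimately have "(\<lambda>n. sqrt (?q n / \<kappa> n) + \<bar>?l n - 1\<bar>) \<longlonglongrightarrow> sqrt 0 + \<bar>1 - 1\<bar>"
      by (intro tendsto_add tendsto_real_sqrt tendsto_rabs tendsto_diff tendsto_const)
    then show "(\<lambda>n. sqrt (?q n / \<kappa> n) + \<bar>?l n - 1\<bar>) \<longlonglongrightarrow> 0"
      by simp
  qed simp
  show ?thesis
    unfolding statistic
    by (rule weak_conv_normalized_quadratic_form[OF N.prob_space_axioms Q F_meas \<xi> char_F _ A_int A_nonneg L1]) simp_all
qed

end
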